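(* Assume that $\Lambda$ is bounded, and let $\varepsilon>0$ and $\delta\in(0,1)$ be given. Consider the modified randomized IPDS algorithm described in the context with a fixed total number of iterations $K\in\mathbb N$ and with $\rho_0=8L_{\mathrm D}$, $\tau_k=\frac{k+1}{k+3}$, $\gamma_k=\eta_k=\frac{\varepsilon}{4(k+3)}$ for all $k\in\mathbb Z_+$. If $K=K'_{\mathsf{det}}:=2\Big\lceil\sqrt{\max\{\Delta_{\rho_0}(x^0,\lambda^0),0\}/\varepsilon}\Big\rceil+1$, then $$\Pr\{\Delta_{\rho_K}(x^K,\lambda^K)\le\varepsilon\}\ge1-\delta.$$ Furthermore, if $$K=K_{\mathsf{det}}:=\left\lceil\frac{2\sqrt{16L_{\mathrm D}B_{\omega,\Lambda}+\Delta(x^0,\lambda^0)}}{\sqrt\varepsilon}\right\rceil+1,\qquad B_{\omega,\Lambda}:=\sup_{\lambda\in\Lambda}|\omega(\lambda)|,$$ then $$\Pr\{\Delta(x^K,\lambda^K)\le\varepsilon\}\ge1-\delta.$$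
   Context: Setting. $\mathbb E_1,\mathbb E_2$ are finite-dimensional real normed spaces (norms $\|\cdot\|$, dual norms $\|\cdot\|_*$, pairing $\langle\cdot,\cdot\rangle$). $\mathcal X\subseteq\mathbb E_1$, $\Lambda\subseteq\mathbb E_2$ are nonempty, closed, convex, $\mathcal X$ bounded. $f,g:\mathbb E_1\to\mathbb R\cup\{+\infty\}$, $h:\mathbb E_2\to\mathbb R\cup\{+\infty\}$ are convex, closed, proper, $\mathcal X\subseteq\mathrm{dom}\,g$, $\Lambda\subseteq\mathrm{dom}\,h$. $f$ is differentiable on an open set containing $\mathcal X$, and $\frac\mu2\|x-x'\|^2\le f(x)-f(x')-\langle\nabla f(x'),x-x'\rangle\le\frac L2\|x-x'\|^2$ for $x,x'\in\mathcal X$, with $L\ge\mu>0$. $\Phi:\mathbb E_1\times\mathbb E_2\to\mathbb R$ is convex in $x$, concave in $\lambda$, differentiable in each argument, and for all $x,x'\in\mathcal X$, $\lambda,\lambda'\in\Lambda$: $\|\nabla_x\Phi(x,\lambda)-\nabla_x\Phi(x',\lambda)\|_*\le L_{xx}\|x-x'\|$, $\|\nabla_x\Phi(x,\lambda)-\nabla_x\Phi(x,\lambda')\|_*\le L_{\lambda x}\|\lambda-\lambda'\|$, $\|\nabla_\lambda\Phi(x,\lambda)-\nabla_\lambda\Phi(x',\lambda)\|_*\le L_{\lambda x}\|x-x'\|$, $\|\nabla_\lambda\Phi(x,\lambda)-\nabla_\lambda\Phi(x,\lambda')\|_*\le L_{\lambda\lambda}\|\lambda-\lambda'\|$. The problem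 is $\min_{x\in\mathcal X}\max_{\lambda\in\Lambda}S(x,\lambda)$, $S(x,\lambda):=f(x)+g(x)+\Phi(x,\lambda)-h(\lambda)$; a saddle point on $\mathcal X\times\Lambda$ exists. $\omega:\mathbb E_2\to\mathbb R\cup\{+\infty\}$ is convex, closed, proper, $1$-strongly convex and continuous (finite) on $\Lambda$, and essentially smooth. $L_{\mathrm D}:=L_{\lambda\lambda}+L_{\lambda x}^2/\mu$ (the requirement $\rho_0=8L_{\mathrm D}>0$ means $L_{\mathrm D}>0$). Definitions. $\psi^{\mathrm P}(x):=\sup_{\lambda\in\Lambda}S(x,\lambda)$, $\psi^{\mathrm D}(\lambda):=\inf_{x\in\mathcal X}S(x,\lambda)$, $\Delta(x,\lambda):=\psi^{\mathrm P}(x)-\psi^{\mathrm D}(\lambda)$. For $\rho>0$: $S_\rho(x,\lambda):=S(x,\lambda)-\rho\,\omega(\lambda)$, $\psi^{\mathrm P}_\rho(x):=\sup_{\lambda\in\Lambda}S_\rho(x,\lambda)$, and $\Delta_\rho(x,\lambda):=\psi^{\mathrm P}_\rho(x)-\psi^{\mathrm D}(\lambda)$. Modified randomized IPDS algorithm. Deterministic starting point $(x^0,\lambda^0)\in\mathcal X\times\Lambda$. For $k=0,1,\dots,K-1$: (1) a randomized method produces $\widetilde\lambda_{\rho_k,\eta_k}(x^k)\in\Lambda$ with $\mathbb E[\psi^{\mathrm P}_{\rho_k}(x^k)-S_{\rho_k}(x^k,\widetilde\lambda_{\rho_k,\eta_k}(x^k))\mid\mathcal F_{k,0}]\le\eta_k\delta/(3K)$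 a.s.; (2) $\hat\lambda^k=\tau_k\lambda^k+(1-\tau_k)\widetilde\lambda_{\rho_k,\eta_k}(x^k)$; (3) a randomized method produces $\widetilde x_{\gamma_k}(\hat\lambda^k)\in\mathcal X$ with $\mathbb E[S(\widetilde x_{\gamma_k}(\hat\lambda^k),\hat\lambda^k)-\psi^{\mathrm D}(\hat\lambda^k)\mid\mathcal F_{k,1}]\le\gamma_k\delta/(3K)$ a.s.; (4) $x^{k+1}=\tau_kx^k+(1-\tau_k)\widetilde x_{\gamma_k}(\hat\lambda^k)$; (5) $\rho_{k+1}=\tau_k\rho_k$; (6) a randomized method produces $\widetilde\lambda_{\rho_{k+1},\eta_k}(x^{k+1})\in\Lambda$ with $\mathbb E[\psi^{\mathrm P}_{\rho_{k+1}}(x^{k+1})-S_{\rho_{k+1}}(x^{k+1},\widetilde\lambda_{\rho_{k+1},\eta_k}(x^{k+1}))\mid\mathcal F_{k,2}]\le\eta_k\delta/(3K)$ a.s.; (7) $\lambda^{k+1}=\tau_k\lambda^k+(1-\tau_k)\widetilde\lambda_{\rho_{k+1},\eta_k}(x^{k+1})$. Filtration: $\mathcal F_{0,0}$ is trivial, $\mathcal F_{k,1}$ is generated by $\mathcal F_{k,0}$ and $\widetilde\lambda_{\rho_k,\eta_k}(x^k)$; $\mathcal F_{k,2}$ by $\mathcal F_{k,1}$ and $\widetilde x_{\gamma_k}(\hat\lambda^k)$; $\mathcal F_{k+1,0}$ by $\mathcal F_{k,2}$ and $\widetilde\lambda_{\rho_{k+1},\eta_k}(x^{k+1})$. *)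

theory Defs
  imports "HOL-Probability.Probability"
begin

(* Spaces carrying an arbitrary norm.  The class euclidean_space is too narrow here: it forces
   the norm to come from an inner product. *)
class fin_dim_normed = real_normed_vector +
  assumes finite_spanning_set: "\<exists>B. finite B \<and> (\<forall>x. \<exists>c. x = (\<Sum>b\<in>B. c b *\<^sub>R b))"

definition edom :: "('a \<Rightarrow> ereal) \<Rightarrow> 'a set" where
  "edom f = {x. f x < \<infinity>}"

definition eepi :: "('a \<Rightarrow> ereal) \<Rightarrow> ('a \<times> real) set" where
  "eepi f = {(x, r). f x \<le> ereal r}"

definition proper_fun :: "('a \<Rightarrow> ereal) \<Rightarrow> bool" where
  "proper_fun f \<longleftrightarrow> (\<forall>x. f x \<noteq> -\<infinity>) \<and> edom f \<noteq> {}"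

definition closed_convex_proper :: "('a::real_normed_vector \<Rightarrow> ereal) \<Rightarrow> bool" where
  "closed_convex_proper f \<longleftrightarrow> convex (eepi f) \<and> closed (eepi f) \<and> proper_fun f"

definition strongly_convex_on ::
    "real \<Rightarrow> 'a set \<Rightarrow> ('a::real_normed_vector \<Rightarrow> ereal) \<Rightarrow> bool" where
  "strongly_convex_on \<sigma> C f \<longleftrightarrow>
     (\<forall>x\<in>C. \<forall>y\<in>C. \<forall>t\<in>{0..1}.
        f ((1 - t) *\<^sub>R x + t *\<^sub>R y) + ereal (\<sigma> / 2 * t * (1 - t) * (norm (x - y))\<^sup>2)
          \<le> ereal (1 - t) * f x + ereal t * f y)"

(* The gradient is an element of the dual space of bounded linear functionals: application is
   the duality pairing and the norm of this type, the operator norm, is the dual norm.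
   Meaningful only at points of differentiability. *)
definition grad :: "('a::real_normed_vector \<Rightarrow> real) \<Rightarrow> 'a \<Rightarrow> 'a \<Rightarrow>\<^sub>L real" where
  "grad F x = Blinfun (frechet_derivative F (at x))"

(* Essential smoothness in the sense of Rockafellar, Convex Analysis, Section 26. *)
definition essentially_smooth :: "('a::real_normed_vector \<Rightarrow> ereal) \<Rightarrow> bool" where
  "essentially_smooth f \<longleftrightarrow>
     interior (edom f) \<noteq> {} \<and>
     (\<forall>x\<in>interior (edom f). (\<lambda>y. real_of_ereal (f y)) differentiable (at x)) \<and>
     (\<forall>u z. (\<forall>n. u n \<in> interior (edom f)) \<and> u \<longlonglongrightarrow> z \<and> z \<in> frontier (interior (edom f)) \<longrightarrow>
        filterlim (\<lambda>n. norm (grad (\<lambda>y. real_of_ereal (f y)) (u n))) at_top sequentially)"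

definition smoothed :: "('a \<Rightarrow> 'b \<Rightarrow> ereal) \<Rightarrow> ('b \<Rightarrow> ereal) \<Rightarrow> real \<Rightarrow> 'a \<Rightarrow> 'b \<Rightarrow> ereal" where
  "smoothed S \<omega> \<rho> x l = S x l - ereal \<rho> * \<omega> l"

definition primal_fun :: "'b set \<Rightarrow> ('a \<Rightarrow> 'b \<Rightarrow> ereal) \<Rightarrow> 'a \<Rightarrow> ereal" where
  "primal_fun \<Lambda> S x = (SUP l\<in>\<Lambda>. S x l)"

definition dual_fun :: "'a set \<Rightarrow> ('a \<Rightarrow> 'b \<Rightarrow> ereal) \<Rightarrow> 'b \<Rightarrow> ereal" where
  "dual_fun X S l = (INF x\<in>X. S x l)"

definition gap :: "'a set \<Rightarrow> 'b set \<Rightarrow> ('a \<Rightarrow> 'b \<Rightarrow> ereal) \<Rightarrow> 'a \<Rightarrow> 'b \<Rightarrow> ereal" where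
  "gap X \<Lambda> S x l = primal_fun \<Lambda> S x - dual_fun X S l"

(* Only the primal function is smoothed. *)
definition smoothed_gap ::
    "'a set \<Rightarrow> 'b set \<Rightarrow> ('a \<Rightarrow> 'b \<Rightarrow> ereal) \<Rightarrow> ('b \<Rightarrow> ereal) \<Rightarrow> real \<Rightarrow> 'a \<Rightarrow> 'b \<Rightarrow> ereal" where
  "smoothed_gap X \<Lambda> S \<omega> \<rho> x l = primal_fun \<Lambda> (smoothed S \<omega> \<rho>) x - dual_fun X S l"

definition join_sigma :: "'w measure \<Rightarrow> ('w \<Rightarrow> 'c::topological_space) \<Rightarrow> 'w measure" where
  "join_sigma F Y = sigma (space F) (sets F \<union> {Y -` A \<inter> space F | A. A \<in> sets borel})"

(* In the following, lt, xt and lu are the outputs of the randomized solvers of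
   steps (1), (3) and (6). *)
primrec F0 :: "'w measure \<Rightarrow> (nat \<Rightarrow> 'w \<Rightarrow> 'b::topological_space) \<Rightarrow>
    (nat \<Rightarrow> 'w \<Rightarrow> 'a::topological_space) \<Rightarrow> (nat \<Rightarrow> 'w \<Rightarrow> 'b) \<Rightarrow> nat \<Rightarrow> 'w measure" where
  "F0 M lt xt lu 0 = sigma (space M) {}"
| "F0 M lt xt lu (Suc k) =
     join_sigma (join_sigma (join_sigma (F0 M lt xt lu k) (lt k)) (xt k)) (lu k)"

definition F1 :: "'w measure \<Rightarrow> (nat \<Rightarrow> 'w \<Rightarrow> 'b::topological_space) \<Rightarrow>
    (nat \<Rightarrow> 'w \<Rightarrow> 'a::topological_space) \<Rightarrow> (nat \<Rightarrow> 'w \<Rightarrow> 'b) \<Rightarrow> nat \<Rightarrow> 'w measure" where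
  "F1 M lt xt lu k = join_sigma (F0 M lt xt lu k) (lt k)"

definition F2 :: "'w measure \<Rightarrow> (nat \<Rightarrow> 'w \<Rightarrow> 'b::topological_space) \<Rightarrow>
    (nat \<Rightarrow> 'w \<Rightarrow> 'a::topological_space) \<Rightarrow> (nat \<Rightarrow> 'w \<Rightarrow> 'b) \<Rightarrow> nat \<Rightarrow> 'w measure" where
  "F2 M lt xt lu k = join_sigma (F1 M lt xt lu k) (xt k)"

(* x and l are the primal and dual iterates, lh the points of step (2).  The solver errors are
   nonnegative, so their conditional expectations are taken in [0, \<infinity>] and no integrability has
   to be assumed. *)
locale ipds_run = prob_space M
  for M :: "'w measure" +
  fixes X :: "'a::real_normed_vector set"
    and \<Lambda> :: "'b::real_normed_vector set"
    and S :: "'a \<Rightarrow> 'b \<Rightarrow> ereal"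
    and \<omega> :: "'b \<Rightarrow> ereal"
    and \<delta> :: real
    and K :: nat
    and \<rho> \<tau> \<gamma> \<eta> :: "nat \<Rightarrow> real"
    and x0 :: 'a and l0 :: 'b
    and x :: "nat \<Rightarrow> 'w \<Rightarrow> 'a" and l lh :: "nat \<Rightarrow> 'w \<Rightarrow> 'b"
    and lt :: "nat \<Rightarrow> 'w \<Rightarrow> 'b" and xt :: "nat \<Rightarrow> 'w \<Rightarrow> 'a" and lu :: "nat \<Rightarrow> 'w \<Rightarrow> 'b"
  assumes start_mem: "x0 \<in> X" "l0 \<in> \<Lambda>"
    and start: "\<And>w. w \<in> space M \<Longrightarrow> x 0 w = x0 \<and> l 0 w = l0"
    and step1_rv: "\<And>k. k < K \<Longrightarrow> lt k \<in> borel_measurable M"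
    and step1_mem: "\<And>k w. k < K \<Longrightarrow> w \<in> space M \<Longrightarrow> lt k w \<in> \<Lambda>"
    and step1: "\<And>k. k < K \<Longrightarrow> AE w in M.
      nn_cond_exp M (F0 M lt xt lu k)
        (\<lambda>w. e2ennreal (primal_fun \<Lambda> (smoothed S \<omega> (\<rho> k)) (x k w)
                        - smoothed S \<omega> (\<rho> k) (x k w) (lt k w))) w
      \<le> ennreal (\<eta> k * \<delta> / (3 * real K))"
    and step2: "\<And>k w. k < K \<Longrightarrow> w \<in> space M \<Longrightarrow>
      lh k w = \<tau> k *\<^sub>R l k w + (1 - \<tau> k) *\<^sub>R lt k w"
    and step3_rv: "\<And>k. k < K \<Longrightarrow> xt k \<in> borel_measurable M"
    and step3_mem: "\<And>k w. k < K \<Longrightarrow> w \<in> space M \<Longrightarrow> xt k w \<in> X"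
    and step3: "\<And>k. k < K \<Longrightarrow> AE w in M.
      nn_cond_exp M (F1 M lt xt lu k)
        (\<lambda>w. e2ennreal (S (xt k w) (lh k w) - dual_fun X S (lh k w))) w
      \<le> ennreal (\<gamma> k * \<delta> / (3 * real K))"
    and step4: "\<And>k w. k < K \<Longrightarrow> w \<in> space M \<Longrightarrow>
      x (Suc k) w = \<tau> k *\<^sub>R x k w + (1 - \<tau> k) *\<^sub>R xt k w"
    and step5: "\<And>k. k < K \<Longrightarrow> \<rho> (Suc k) = \<tau> k * \<rho> k"
    and step6_rv: "\<And>k. k < K \<Longrightarrow> lu k \<in> borel_measurable M"
    and step6_mem: "\<And>k w. k < K \<Longrightarrow> w \<in> space M \<Longrightarrow> lu k w \<in> \<Lambda>"
    and step6: "\<And>k. k < K \<Longrightarrow> AE w in M.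
      nn_cond_exp M (F2 M lt xt lu k)
        (\<lambda>w. e2ennreal (primal_fun \<Lambda> (smoothed S \<omega> (\<rho> (Suc k))) (x (Suc k) w)
                        - smoothed S \<omega> (\<rho> (Suc k)) (x (Suc k) w) (lu k w))) w
      \<le> ennreal (\<eta> k * \<delta> / (3 * real K))"
    and step7: "\<And>k w. k < K \<Longrightarrow> w \<in> space M \<Longrightarrow>
      l (Suc k) w = \<tau> k *\<^sub>R l k w + (1 - \<tau> k) *\<^sub>R lu k w"

end

theory Submission
  imports Defs
begin

text \<open>
  The argument is Nesterov's excessive-gap argument with inexact oracles. Let
  \<open>\<Delta>\<^sub>k\<close> be the smoothed gap at \<open>(x\<^sup>k, \<lambda>\<^sup>k)\<close> with smoothing parameter \<open>\<rho>\<^sub>k\<close>, and let \<open>e\<^sub>1, e\<^sub>2, e\<^sub>3\<close>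
  be the errors of the three solver calls of an iteration. One iteration satisfies
  \<open>\<Delta>\<^sub>k\<^sub>+\<^sub>1 \<le> \<tau>\<^sub>k \<Delta>\<^sub>k + \<tau>\<^sub>k e\<^sub>1 + 2 e\<^sub>2 + e\<^sub>3\<close> as soon as \<open>4 L\<^sub>D (1 - \<tau>\<^sub>k)\<^sup>2 \<le> \<tau>\<^sub>k \<rho>\<^sub>k\<close>
  (lemma \<open>gap_step\<close>). The primal side uses that \<open>S\<^sub>\<rho>(x, \<cdot>)\<close> is \<open>\<rho>\<close>-strongly concave, so up to
  the solver error every point lies below the optimal value by a multiple of its squared distance
  to a near-maximizer (\<open>near_maximizer_growth\<close>). The dual side uses that the linearization of \<open>\<Phi>(x, \<cdot>)\<close> at \<open>\<lambda>\<close>, for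
  a near-minimizer \<open>x\<close> of \<open>S(\<cdot>, \<lambda>)\<close>, is an inexact first-order oracle for the dual function
  (\<open>dual_inexact_oracle\<close>). Both growth estimates evaluate the function at the midpoint
  between the given point and the near-optimal one, so they apply to near-optimal points directly.

  With \<open>\<tau>\<^sub>k = (k + 1) / (k + 3)\<close> one has \<open>\<rho>\<^sub>k = 16 L\<^sub>D / ((k + 1) (k + 2))\<close>, and multiplying the
  recursion by \<open>(k + 2) (k + 3)\<close> makes it telescope (\<open>accumulated_gap\<close>):
  \<open>(K + 1) (K + 2) \<Delta>\<^sub>K \<le> 2 \<Delta>\<^sub>0 + T\<close>, where \<open>T\<close> is a weighted sum of all solver errors. Both
  choices of \<open>K\<close> are made so that \<open>T \<le> \<epsilon> K (K + 3) / 2\<close> implies the claimed gap bound; for the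
  unsmoothed gap, smoothing costs at most \<open>\<rho>\<^sub>K B\<close> at the end and \<open>\<rho>\<^sub>0 B\<close> at the start, where \<open>B\<close>
  bounds \<open>\<bar>\<omega>\<bar>\<close> on \<open>\<Lambda>\<close>.

  The random part only has to control \<open>T\<close>. A bound on a conditional expectation bounds the
  expectation, so the solver guarantees give \<open>E T \<le> \<delta> \<epsilon> K (K + 3) / 2\<close>, and a single application
  of Markov's inequality to the whole sum yields probability at least \<open>1 - \<delta>\<close>.

  What remains is measurability of the errors and of the final gap. The primal function is a
  supremum, and the dual function an infimum, over uncountably many continuous functions, up to
  a closed convex term; semicontinuity settles this. The coupling \<open>\<Phi>\<close> is continuous in each
  argument separately, hence measurable along measurable iterates (\<open>borel_measurable_Caratheodory\<close>).
  This and the boundedness of \<open>\<omega>\<close> on \<open>\<Lambda>\<close> need a finite-dimensional normed space to be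
  separable and to have compact closed bounded sets.
\<close>

section \<open>Compactness and separability of finite-dimensional normed spaces\<close>

text \<open>Induction on the spanning set. The induction hypothesis makes the smaller span closed, so a
  further vector outside it has positive distance from it. This bounds the coefficient of that
  vector along the sequence, and the coefficients and the remainders can be thinned out in turn.\<close>

lemma span_bounded_imp_convergent_subsequence:
  fixes B :: "'a::real_normed_vector set"
  assumes "finite B" "bounded (range u)" "\<And>n. u n \<in> span B"
  shows "\<exists>z\<in>span B. \<exists>r. strict_mono (r::nat \<Rightarrow> nat) \<and> (u \<circ> r) \<longlonglongrightarrow> z"
  using assms
proof (induction B arbitrary: u rule: finite_induct)
  case empty
  then have "u = (\<lambda>n. 0)" by auto
  then show ?case by (auto intro!: exI[of _ id] simp: strict_mono_def comp_def)
next
  case (insert b B u)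
  have closed: "closed (span B)"
    unfolding closed_sequential_limits
  proof (intro allI impI, elim conjE)
    fix v z assume v: "\<forall>n. v n \<in> span B" and lim: "v \<longlonglongrightarrow> z"
    have "bounded (range v)" using lim by (intro convergent_imp_bounded)
    then obtain z' r where "z' \<in> span B" "strict_mono r" "(v \<circ> r) \<longlonglongrightarrow> z'"
      using insert.IH[of v] v by blast
    then show "z \<in> span B"
      using lim LIMSEQ_subseq_LIMSEQ LIMSEQ_unique by blast
  qed
  show ?case
  proof (cases "b \<in> span B")
    case True
    then show ?thesis using insert by (metis span_redundant)
  next
    case False
    obtain d where d: "d > 0" "ball b d \<subseteq> - span B"
      using closed False open_contains_ball[of "- span B"] by (metis ComplI open_Compl)
    have "\<exists>c y. u n = c *\<^sub>R b + y \<and> y \<in> span B" for n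
      using insert.prems(2)[of n] span_breakdown_eq by (metis add.commute diff_add_cancel)
    then obtain c y where cy: "\<And>n. u n = c n *\<^sub>R b + y n" "\<And>n. y n \<in> span B" by metis
    obtain R where R: "\<And>n. norm (u n) \<le> R"
      using insert.prems(1) by (auto simp: bounded_iff)
    \<comment> \<open>The coefficient of \<open>b\<close> is controlled because \<open>b\<close> has positive distance from the span of the others.\<close>
    have c_bound: "\<bar>c n\<bar> \<le> R / d" for n
    proof (cases "c n = 0")
      case True
      then show ?thesis using R[of 0] d norm_ge_zero[of "u 0"] by (simp add: order_trans[OF norm_ge_zero R])
    next
      case False
      have "- (1 / c n) *\<^sub>R y n \<in> span B" using cy(2) by (intro span_mul)
      then have "d \<le> dist b (- (1 / c n) *\<^sub>R y n)" using d by (force simp: subset_eq)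
      also have "\<dots> = norm ((1 / c n) *\<^sub>R u n)"
        using False by (simp add: dist_norm cy(1) scaleR_right_distrib)
      also have "\<dots> = norm (u n) / \<bar>c n\<bar>" by simp
      finally have "d * \<bar>c n\<bar> \<le> norm (u n)" using False by (simp add: field_simps)
      then show ?thesis using R[of n] d by (simp add: field_simps)
    qed
    then have "bounded (range c)" by (auto simp: bounded_iff)
    then obtain c' r where r: "strict_mono r" "(c \<circ> r) \<longlonglongrightarrow> c'"
      using bounded_imp_convergent_subsequence by blast
    have "bounded (range (y \<circ> r))"
    proof -
      have "norm (y n) \<le> R + R / d * norm b" for n
      proof -
        have "norm (y n) = norm (u n - c n *\<^sub>R b)" by (simp add: cy(1))
        also have "\<dots> \<le> norm (u n) + \<bar>c n\<bar> * norm b" using norm_triangle_ineq4[of "u n" "c n *\<^sub>R b"] by simp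
        finally show ?thesis using R[of n] mult_right_mono[OF c_bound[of n] norm_ge_zero[of b]] by linarith
      qed
      then show ?thesis by (auto simp: bounded_iff)
    qed
    then obtain y' s where s: "y' \<in> span B" "strict_mono s" "((y \<circ> r) \<circ> s) \<longlonglongrightarrow> y'"
      using insert.IH[OF \<open>bounded (range (y \<circ> r))\<close>] cy(2) unfolding comp_def by blast
    have "(\<lambda>n. ((c \<circ> r) \<circ> s) n *\<^sub>R b + ((y \<circ> r) \<circ> s) n) \<longlonglongrightarrow> c' *\<^sub>R b + y'"
      using LIMSEQ_subseq_LIMSEQ[OF r(2) s(2)] s(3) by (intro tendsto_intros)
    then have "(u \<circ> (r \<circ> s)) \<longlonglongrightarrow> c' *\<^sub>R b + y'" by (simp add: cy(1) comp_def)
    moreover have "c' *\<^sub>R b + y' \<in> span (insert b B)"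
      by (meson insertI1 s(1) span_add span_base span_mul span_mono subset_insertI subsetD)
    moreover have "strict_mono (r \<circ> s)" using r s by (simp add: strict_mono_o)
    ultimately show ?thesis by blast
  qed
qed

instance fin_dim_normed \<subseteq> heine_borel
proof
  fix u :: "nat \<Rightarrow> 'a" assume bounded: "bounded (range u)"
  obtain B :: "'a set" where B: "finite B" "\<And>x. \<exists>c. x = (\<Sum>b\<in>B. c b *\<^sub>R b)"
    using finite_spanning_set by blast
  have span: "x \<in> span B" for x
  proof -
    obtain c where "x = (\<Sum>b\<in>B. c b *\<^sub>R b)" using B(2) by blast
    then show ?thesis by (simp add: span_sum span_mul span_base)
  qed
  show "\<exists>l r. strict_mono (r::nat \<Rightarrow> nat) \<and> ((u \<circ> r) \<longlongrightarrow> l) sequentially"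
    using span_bounded_imp_convergent_subsequence[OF B(1) bounded span] by blast
qed

text \<open>Rational combinations of a finite spanning set are dense.\<close>

lemma fin_dim_countable_dense:
  "\<exists>D::'a::fin_dim_normed set. countable D \<and> (\<forall>x. \<forall>e>0. \<exists>y\<in>D. dist y x < e)"
proof -
  obtain B :: "'a set" where B: "finite B" "\<And>x. \<exists>c. x = (\<Sum>b\<in>B. c b *\<^sub>R b)"
    using finite_spanning_set by blast
  define D where "D = (\<lambda>c. \<Sum>b\<in>B. c b *\<^sub>R b) ` (B \<rightarrow>\<^sub>E (\<rat>::real set))"
  have "countable D" unfolding D_def
    using B(1) by (intro countable_image countable_PiE countable_rat) auto
  moreover have "\<exists>y\<in>D. dist y x < e" if "e > 0" for x :: 'a and e :: real
  proof -
    obtain c where c: "x = (\<Sum>b\<in>B. c b *\<^sub>R b)" using B(2) by blast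
    define s where "s = 1 + (\<Sum>b\<in>B. norm b)"
    have s: "s > 0" unfolding s_def by (smt (verit) sum_nonneg norm_ge_zero)
    have "\<exists>q\<in>\<rat>. c b < q \<and> q < c b + e / s" for b
      using Rats_dense_in_real[of "c b" "c b + e / s"] that s by auto
    then obtain q where q: "\<And>b. q b \<in> \<rat>" "\<And>b. c b < q b \<and> q b < c b + e / s" by metis
    let ?y = "\<Sum>b\<in>B. restrict q B b *\<^sub>R b"
    have "?y \<in> D" unfolding D_def using q(1) by (intro imageI) auto
    moreover have "dist ?y x < e"
    proof -
      \<comment> \<open>The summand \<open>1\<close> in \<open>s\<close> keeps the quotient \<open>e / s\<close> defined and the final estimate strict.\<close>
      have "?y - x = (\<Sum>b\<in>B. (q b - c b) *\<^sub>R b)"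
        unfolding c sum_subtractf[symmetric] by (intro sum.cong) (auto simp: scaleR_left_diff_distrib)
      then have "dist ?y x \<le> (\<Sum>b\<in>B. norm ((q b - c b) *\<^sub>R b))"
        unfolding dist_norm using norm_sum by metis
      also have "\<dots> \<le> (\<Sum>b\<in>B. e / s * norm b)"
      proof (rule sum_mono)
        fix b
        have "\<bar>q b - c b\<bar> \<le> e / s" using q(2)[of b] by linarith
        then show "norm ((q b - c b) *\<^sub>R b) \<le> e / s * norm b"
          using mult_right_mono[OF _ norm_ge_zero[of b]] by (metis norm_scaleR)
      qed
      also have "\<dots> = e / s * (s - 1)" by (simp add: sum_distrib_left s_def)
      also have "\<dots> < e" using s that by (simp add: field_simps)
      finally show ?thesis .
    qed
    ultimately show ?thesis by blast
  qed
  ultimately show ?thesis by blast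
qed

instance fin_dim_normed \<subseteq> second_countable_topology
proof
  obtain D :: "'a set" where D: "countable D" "\<And>x e. e > 0 \<Longrightarrow> \<exists>y\<in>D. dist y x < e"
    using fin_dim_countable_dense by blast
  define B where "B = (\<lambda>(y, n). ball y (1 / Suc n)) ` (D \<times> (UNIV :: nat set))"
  have "topological_basis B"
  proof (rule topological_basisI)
    show "open U" if "U \<in> B" for U using that by (auto simp: B_def)
    fix U :: "'a set" and z assume "open U" "z \<in> U"
    then obtain e where e: "e > 0" "ball z e \<subseteq> U" using open_contains_ball by blast
    obtain n where n: "2 / e < Suc n" using reals_Archimedean2 less_trans
      by (metis lessI of_nat_less_iff)
    then have n': "2 / real (Suc n) < e" using e by (simp add: field_simps)
    obtain y where y: "y \<in> D" "dist y z < 1 / Suc n" using D(2)[of "1 / Suc n"] by auto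
    have "ball y (1 / Suc n) \<subseteq> ball z e"
    proof
      fix t assume "t \<in> ball y (1 / Suc n)"
      then have "dist z t < 1 / Suc n + 1 / Suc n"
        using y dist_triangle[of z t y] by (simp add: dist_commute)
      also have "\<dots> = 2 / Suc n" by (simp add: field_simps)
      finally show "t \<in> ball z e" using n' by simp
    qed
    then show "\<exists>V\<in>B. z \<in> V \<and> V \<subseteq> U"
      using y e by (intro bexI[of _ "ball y (1 / Suc n)"]) (auto simp: B_def)
  qed
  then have "open = generate_topology B" by (rule topological_basis_imp_subbasis)
  moreover have "countable B" using D(1) by (simp add: B_def)
  ultimately show "\<exists>B::'a set set. countable B \<and> open = generate_topology B" by blast
qed

section \<open>Convex functions and their gradients\<close>

lemma has_derivative_grad:
  "F differentiable (at v) \<Longrightarrow> (F has_derivative blinfun_apply (grad F v)) (at v)"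
  unfolding grad_def using frechet_derivative_works has_derivative_bounded_linear
  by (metis bounded_linear_Blinfun_apply)

lemma has_real_derivative_along_line:
  assumes "F differentiable (at (y + t *\<^sub>R d))"
  shows "((\<lambda>s. F (y + s *\<^sub>R d)) has_real_derivative grad F (y + t *\<^sub>R d) d) (at t)"
proof -
  have "((\<lambda>s. y + s *\<^sub>R d) has_derivative (\<lambda>s. s *\<^sub>R d)) (at t)"
    by (auto intro!: derivative_eq_intros)
  moreover have "(\<lambda>s. grad F (y + t *\<^sub>R d) (s *\<^sub>R d)) = (*) (grad F (y + t *\<^sub>R d) d)"
    by (auto simp: fun_eq_iff blinfun.scaleR_right)
  ultimately show ?thesis
    using has_derivative_compose[of "\<lambda>s. y + s *\<^sub>R d" _ t UNIV F, OF _ has_derivative_grad[OF assms]]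
    unfolding has_field_derivative_def by metis
qed

lemma convex_on_above_tangent:
  assumes "convex_on UNIV F" "F differentiable (at y)"
  shows "F y + grad F y (z - y) \<le> F z"
proof -
  let ?u = "\<lambda>s::real. F (y + s *\<^sub>R (z - y))"
  have "convex_on UNIV ?u"
  proof (rule convex_onI)
    fix t a b :: real assume "0 < t" "t < 1"
    then have "F ((1 - t) *\<^sub>R (y + a *\<^sub>R (z - y)) + t *\<^sub>R (y + b *\<^sub>R (z - y)))
        \<le> (1 - t) * ?u a + t * ?u b"
      using assms(1) by (intro convex_onD) auto
    moreover have "(1 - t) *\<^sub>R (y + a *\<^sub>R (z - y)) + t *\<^sub>R (y + b *\<^sub>R (z - y))
        = y + ((1 - t) *\<^sub>R a + t *\<^sub>R b) *\<^sub>R (z - y)"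
      by (simp add: algebra_simps)
    ultimately show "?u ((1 - t) *\<^sub>R a + t *\<^sub>R b) \<le> (1 - t) * ?u a + t * ?u b" by simp
  qed auto
  moreover have "(?u has_real_derivative grad F y (z - y)) (at 0)"
    using has_real_derivative_along_line[of F y 0 "z - y"] assms(2) by simp
  ultimately have "?u 1 - ?u 0 \<ge> grad F y (z - y) * (1 - 0)"
    by (intro convex_on_imp_above_tangent[where A = UNIV]) auto
  then show ?thesis by simp
qed

text \<open>The lower half of the descent lemma. Along the segment from \<open>y\<close> to \<open>z\<close>, the Lipschitz bound
  makes the difference of the two sides a nondecreasing function. The gradient only has to be
  Lipschitz on the convex set containing the segment.\<close>

lemma lipschitz_grad_lower_bound:
  assumes "convex C" "y \<in> C" "z \<in> C" "\<And>v. v \<in> C \<Longrightarrow> F differentiable (at v)"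
    and lip: "c-lipschitz_on C (grad F)"
  shows "F y + grad F y (z - y) - c / 2 * (norm (z - y))\<^sup>2 \<le> F z"
proof -
  define d where "d = z - y"
  define u where "u t = F (y + t *\<^sub>R d) - t * grad F y d + c / 2 * t\<^sup>2 * (norm d)\<^sup>2" for t
  have "u 0 \<le> u 1"
  proof (rule DERIV_nonneg_imp_nondecreasing[where f = u])
    fix t :: real assume t: "0 \<le> t" "t \<le> 1"
    have mem: "y + t *\<^sub>R d \<in> C"
      using convexD_alt[OF assms(1,2,3) t] by (simp add: d_def algebra_simps)
    have "\<bar>(grad F (y + t *\<^sub>R d) - grad F y) d\<bar> \<le> norm (grad F (y + t *\<^sub>R d) - grad F y) * norm d"
      using norm_blinfun[of "grad F (y + t *\<^sub>R d) - grad F y" d] by simp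
    also have "\<dots> \<le> (c * (t * norm d)) * norm d"
      using lipschitz_onD[OF lip mem assms(2)] t
      by (intro mult_right_mono) (auto simp: dist_norm)
    finally have "0 \<le> grad F (y + t *\<^sub>R d) d - grad F y d + c * t * (norm d)\<^sup>2"
      by (simp add: blinfun.diff_left power2_eq_square mult.assoc)
    moreover have "DERIV u t :> grad F (y + t *\<^sub>R d) d - grad F y d + c * t * (norm d)\<^sup>2"
      unfolding u_def using has_real_derivative_along_line[OF assms(4)[OF mem]]
      by (auto intro!: derivative_eq_intros)
    ultimately show "\<exists>D. DERIV u t :> D \<and> 0 \<le> D" by blast
  qed auto
  then show ?thesis by (simp add: u_def d_def)
qed

text \<open>The strong convexity inequality at the midpoint alone: this is all the gap recursion uses. The
  factor \<open>1/8\<close> is \<open>t (1 - t) / 2\<close> at \<open>t = 1/2\<close>, so \<open>\<sigma>\<close> is the usual modulus.\<close>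

definition midpoint_strongly_convex_on ::
    "real \<Rightarrow> 'a::real_normed_vector set \<Rightarrow> ('a \<Rightarrow> real) \<Rightarrow> bool" where
  "midpoint_strongly_convex_on \<sigma> C F \<longleftrightarrow>
     (\<forall>x\<in>C. \<forall>y\<in>C. F ((1/2) *\<^sub>R x + (1/2) *\<^sub>R y) + \<sigma> / 8 * (norm (x - y))\<^sup>2 \<le> (F x + F y) / 2)"

text \<open>Expanding at the midpoint towards both end points, the gradient terms cancel.\<close>

lemma midpoint_strongly_convex_on_if_grad_growth:
  assumes "convex C"
    and growth: "\<And>z z'. z \<in> C \<Longrightarrow> z' \<in> C \<Longrightarrow> \<mu> / 2 * (norm (z - z'))\<^sup>2 \<le> F z - F z' - grad F z' (z - z')"
  shows "midpoint_strongly_convex_on \<mu> C F"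
  unfolding midpoint_strongly_convex_on_def
proof (intro ballI)
  fix x y assume xy: "x \<in> C" "y \<in> C"
  define m where "m = (1/2) *\<^sub>R x + (1/2) *\<^sub>R y"
  have m: "m \<in> C" using convexD[OF assms(1) xy, of "1/2" "1/2"] by (simp add: m_def)
  have h: "(1/2) *\<^sub>R v - v = - (1/2) *\<^sub>R v" for v :: 'a
    using scaleR_left_diff_distrib[of "1/2" 1 v] by simp
  have dx: "x - m = (1/2) *\<^sub>R (x - y)" and dy: "y - m = (- (1/2)) *\<^sub>R (x - y)"
    using h[of x] h[of y] by (simp_all add: m_def algebra_simps)
  show "F ((1/2) *\<^sub>R x + (1/2) *\<^sub>R y) + \<mu> / 8 * (norm (x - y))\<^sup>2 \<le> (F x + F y) / 2"
    using growth[OF xy(1) m] growth[OF xy(2) m] unfolding dx dy blinfun.scaleR_right norm_scaleR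
    by (simp add: m_def[symmetric] power_mult_distrib power2_eq_square)
qed

lemma real_of_ereal_works_on_edom:
  "proper_fun f \<Longrightarrow> z \<in> edom f \<Longrightarrow> ereal (real_of_ereal (f z)) = f z"
  unfolding proper_fun_def edom_def by (cases "f z") auto

lemma convex_on_real_of_ereal:
  assumes "closed_convex_proper f" "C \<subseteq> edom f" "convex C"
  shows "convex_on C (\<lambda>z. real_of_ereal (f z))"
proof (rule convex_onI[OF _ assms(3)])
  fix t :: real and x y assume t: "0 < t" "t < 1" and xy: "x \<in> C" "y \<in> C"
  have fin: "ereal (real_of_ereal (f z)) = f z" if "z \<in> C" for z
    using assms(1,2) that unfolding closed_convex_proper_def
    by (intro real_of_ereal_works_on_edom) auto
  have "(x, real_of_ereal (f x)) \<in> eepi f" "(y, real_of_ereal (f y)) \<in> eepi f"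
    using fin xy by (auto simp: eepi_def)
  then have "(1 - t) *\<^sub>R (x, real_of_ereal (f x)) + t *\<^sub>R (y, real_of_ereal (f y)) \<in> eepi f"
    using assms(1) t unfolding closed_convex_proper_def by (intro convexD) auto
  moreover have "(1 - t) *\<^sub>R x + t *\<^sub>R y \<in> C"
    using assms(3) xy t by (intro convexD) auto
  ultimately have "ereal (real_of_ereal (f ((1 - t) *\<^sub>R x + t *\<^sub>R y)))
      \<le> ereal ((1 - t) * real_of_ereal (f x) + t * real_of_ereal (f y))"
    using fin by (simp add: eepi_def)
  then show "real_of_ereal (f ((1 - t) *\<^sub>R x + t *\<^sub>R y))
      \<le> (1 - t) * real_of_ereal (f x) + t * real_of_ereal (f y)" by simp
qed

lemma midpoint_strongly_convex_on_add_convex: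
  assumes F: "midpoint_strongly_convex_on \<sigma> C F" and G: "convex_on C G"
  shows "midpoint_strongly_convex_on \<sigma> C (\<lambda>z. F z + G z)"
  unfolding midpoint_strongly_convex_on_def
proof (intro ballI)
  fix x y assume xy: "x \<in> C" "y \<in> C"
  have "G ((1/2) *\<^sub>R x + (1/2) *\<^sub>R y) \<le> (G x + G y) / 2"
    using convex_onD[OF G, of "1/2" x y] xy by simp
  moreover have "F ((1/2) *\<^sub>R x + (1/2) *\<^sub>R y) + \<sigma> / 8 * (norm (x - y))\<^sup>2 \<le> (F x + F y) / 2"
    using F xy unfolding midpoint_strongly_convex_on_def by blast
  ultimately show "F ((1/2) *\<^sub>R x + (1/2) *\<^sub>R y) + G ((1/2) *\<^sub>R x + (1/2) *\<^sub>R y)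
      + \<sigma> / 8 * (norm (x - y))\<^sup>2 \<le> (F x + G x + (F y + G y)) / 2"
    by (simp add: add_divide_distrib)
qed

lemma midpoint_strongly_convex_on_real_of_ereal:
  assumes "strongly_convex_on \<sigma> C f" "proper_fun f" "C \<subseteq> edom f" "convex C"
  shows "midpoint_strongly_convex_on \<sigma> C (\<lambda>z. real_of_ereal (f z))"
  unfolding midpoint_strongly_convex_on_def
proof (intro ballI)
  fix x y assume xy: "x \<in> C" "y \<in> C"
  define m where "m = (1/2) *\<^sub>R x + (1/2) *\<^sub>R y"
  have "m \<in> C" using convexD[OF assms(4) xy, of "1/2" "1/2"] by (simp add: m_def)
  then have fin: "ereal (real_of_ereal (f z)) = f z" if "z \<in> {x, y, m}" for z
    using assms(2,3) that xy by (intro real_of_ereal_works_on_edom) auto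
  have "f m + ereal (\<sigma> / 2 * (1/2) * (1 - 1/2) * (norm (x - y))\<^sup>2) \<le> ereal (1 - 1/2) * f x + ereal (1/2) * f y"
    using bspec[OF bspec[OF bspec[OF assms(1)[unfolded strongly_convex_on_def] xy(1)] xy(2)], of "1/2"]
    by (simp add: m_def)
  moreover obtain a b c where "f x = ereal a" "f y = ereal b" "f m = ereal c"
    using fin by (metis insertCI)
  ultimately show "real_of_ereal (f ((1/2) *\<^sub>R x + (1/2) *\<^sub>R y)) + \<sigma> / 8 * (norm (x - y))\<^sup>2
      \<le> (real_of_ereal (f x) + real_of_ereal (f y)) / 2"
    by (simp add: m_def[symmetric] add_divide_distrib)
qed

section \<open>The gap recursion for inexact primal-dual smoothing\<close>

text \<open>The saddle-point problem in terms of finite real functions: \<open>p\<close> stands for \<open>f + g\<close> on \<open>X\<close>,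
  and \<open>q\<close> for \<open>h\<close> on \<open>\<Lambda>\<close>, where the extended-valued data are finite.\<close>

locale smooth_saddle_problem =
  fixes X :: "'a::real_normed_vector set" and \<Lambda> :: "'b::real_normed_vector set"
    and p :: "'a \<Rightarrow> real" and q \<omega> :: "'b \<Rightarrow> real" and \<Phi> :: "'a \<Rightarrow> 'b \<Rightarrow> real"
    and \<mu> Llx Lll B\<omega> :: real
  assumes X: "convex X" "bounded X" "X \<noteq> {}" and \<Lambda>: "convex \<Lambda>" "bounded \<Lambda>" "\<Lambda> \<noteq> {}"
    and p: "convex_on X p" "midpoint_strongly_convex_on \<mu> X p" "\<mu> > 0"
    and q: "convex_on \<Lambda> q"
    and \<omega>: "midpoint_strongly_convex_on 1 \<Lambda> \<omega>" "\<And>v. v \<in> \<Lambda> \<Longrightarrow> \<bar>\<omega> v\<bar> \<le> B\<omega>"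
    and \<Phi>_convex: "\<And>v. convex_on UNIV (\<lambda>z. \<Phi> z v)"
    and \<Phi>_concave: "\<And>z. concave_on UNIV (\<Phi> z)"
    and \<Phi>_diff1: "\<And>z v. (\<lambda>y. \<Phi> y v) differentiable (at z)"
    and \<Phi>_diff2: "\<And>z v. \<Phi> z differentiable (at v)"
    and \<Phi>_xl: "\<And>z. z \<in> X \<Longrightarrow> Llx-lipschitz_on \<Lambda> (\<lambda>v. grad (\<lambda>y. \<Phi> y v) z)"
    and \<Phi>_lx: "\<And>v. v \<in> \<Lambda> \<Longrightarrow> Llx-lipschitz_on X (\<lambda>z. grad (\<Phi> z) v)"
    and \<Phi>_ll: "\<And>z. z \<in> X \<Longrightarrow> Lll-lipschitz_on \<Lambda> (grad (\<Phi> z))"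
    and saddle: "\<exists>z\<in>X. \<exists>v\<in>\<Lambda>. \<forall>z'\<in>X. \<forall>v'\<in>\<Lambda>.
      p z + \<Phi> z v' - q v' \<le> p z + \<Phi> z v - q v \<and> p z + \<Phi> z v - q v \<le> p z' + \<Phi> z' v - q v"
begin

definition payoff :: "'a \<Rightarrow> 'b \<Rightarrow> real" where
  "payoff z v = p z + \<Phi> z v - q v"

definition primal :: "real \<Rightarrow> 'a \<Rightarrow> real" where
  "primal \<rho> z = (SUP v\<in>\<Lambda>. payoff z v - \<rho> * \<omega> v)"

definition dual :: "'b \<Rightarrow> real" where
  "dual v = (INF z\<in>X. payoff z v)"

lemma concave_below_tangent: "\<Phi> z v' \<le> \<Phi> z v + grad (\<Phi> z) v (v' - v)"
proof -
  have "- \<Phi> z v + grad (\<lambda>y. - \<Phi> z y) v (v' - v) \<le> - \<Phi> z v'"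
    using \<Phi>_concave \<Phi>_diff2 by (intro convex_on_above_tangent) (auto simp: concave_on_def)
  moreover have "grad (\<lambda>y. - \<Phi> z y) v = - grad (\<Phi> z) v"
  proof -
    have "((\<lambda>y. - \<Phi> z y) has_derivative (- grad (\<Phi> z) v)) (at v)"
      using has_derivative_minus[OF has_derivative_grad[OF \<Phi>_diff2]]
      by (simp add: uminus_blinfun.rep_eq)
    then show ?thesis
      using has_derivative_unique[OF _ has_derivative_grad] differentiableI
      by (metis blinfun_apply_inject)
  qed
  ultimately show ?thesis by (simp add: uminus_blinfun.rep_eq)
qed

text \<open>This makes the supremum defining the primal function finite. Compare \<open>\<Phi> z v\<close> with its value at
  the saddle point by the tangent at \<open>z\<close>, whose slope is bounded in \<open>v\<close> because it is Lipschitz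
  on the bounded set \<open>\<Lambda>\<close>.\<close>

lemma bdd_above_payoff:
  assumes z: "z \<in> X"
  shows "bdd_above ((\<lambda>v. payoff z v - \<rho> * \<omega> v) ` \<Lambda>)"
proof -
  obtain zs vs where s: "zs \<in> X" "vs \<in> \<Lambda>" "\<And>v. v \<in> \<Lambda> \<Longrightarrow> \<Phi> zs v - q v \<le> \<Phi> zs vs - q vs"
    using saddle by (metis add_diff_eq add_le_cancel_left)
  obtain R where R: "\<And>v. v \<in> \<Lambda> \<Longrightarrow> dist vs v \<le> R"
    using \<Lambda>(2) bounded_any_center by blast
  let ?G = "\<lambda>v. grad (\<lambda>y. \<Phi> y v) z"
  have L: "Llx \<ge> 0" using lipschitz_on_nonneg[OF \<Phi>_xl[OF z]] .
  have "payoff z v - \<rho> * \<omega> v \<le> p z + (\<Phi> zs vs - q vs) + (Llx * R + norm (?G vs)) * norm (zs - z) + \<bar>\<rho>\<bar> * B\<omega>"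
    if v: "v \<in> \<Lambda>" for v
  proof -
    have "\<Phi> z v + ?G v (zs - z) \<le> \<Phi> zs v"
      using \<Phi>_convex \<Phi>_diff1 by (rule convex_on_above_tangent)
    moreover have "- ?G v (zs - z) \<le> (Llx * R + norm (?G vs)) * norm (zs - z)"
    proof -
      have "- ?G v (zs - z) \<le> norm (?G v) * norm (zs - z)"
        using norm_blinfun[of "?G v" "zs - z"] by simp
      also have "norm (?G v) \<le> Llx * dist v vs + norm (?G vs)"
        using lipschitz_onD[OF \<Phi>_xl[OF z] v s(2)] norm_triangle_ineq2[of "?G v" "?G vs"]
        by (simp add: dist_norm)
      also have "\<dots> \<le> Llx * R + norm (?G vs)"
        using R[OF v] L by (simp add: dist_commute mult_left_mono)
      finally show ?thesis by (simp add: mult_right_mono)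
    qed
    moreover have "- (\<rho> * \<omega> v) \<le> \<bar>\<rho>\<bar> * B\<omega>"
    proof -
      have "- (\<rho> * \<omega> v) \<le> \<bar>\<rho>\<bar> * \<bar>\<omega> v\<bar>" by (simp add: abs_mult[symmetric])
      also have "\<dots> \<le> \<bar>\<rho>\<bar> * B\<omega>" using \<omega>(2)[OF v] by (intro mult_left_mono) auto
      finally show ?thesis .
    qed
    ultimately show ?thesis using s(3)[OF v] by (simp add: payoff_def)
  qed
  then show ?thesis by (auto intro!: bdd_aboveI2)
qed

text \<open>The mirror image of the previous argument, with the roles of the two variables exchanged.\<close>

lemma bdd_below_payoff:
  assumes v: "v \<in> \<Lambda>"
  shows "bdd_below ((\<lambda>z. payoff z v) ` X)"
proof -
  obtain zs vs where s: "zs \<in> X" "vs \<in> \<Lambda>" "\<And>z. z \<in> X \<Longrightarrow> p zs + \<Phi> zs vs \<le> p z + \<Phi> z vs"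
    using saddle by (metis diff_le_eq diff_add_cancel)
  obtain R where R: "\<And>z. z \<in> X \<Longrightarrow> dist zs z \<le> R"
    using X(2) bounded_any_center by blast
  let ?G = "\<lambda>z. grad (\<Phi> z) v"
  have L: "Llx \<ge> 0" using lipschitz_on_nonneg[OF \<Phi>_lx[OF v]] .
  have "p zs + \<Phi> zs vs - q v - (Llx * R + norm (?G zs)) * norm (vs - v) \<le> payoff z v"
    if z: "z \<in> X" for z
  proof -
    have "\<Phi> z vs \<le> \<Phi> z v + ?G z (vs - v)" by (rule concave_below_tangent)
    moreover have "?G z (vs - v) \<le> (Llx * R + norm (?G zs)) * norm (vs - v)"
    proof -
      have "?G z (vs - v) \<le> norm (?G z) * norm (vs - v)"
        using norm_blinfun[of "?G z" "vs - v"] by simp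
      also have "norm (?G z) \<le> Llx * dist z zs + norm (?G zs)"
        using lipschitz_onD[OF \<Phi>_lx[OF v] z s(1)] norm_triangle_ineq2[of "?G z" "?G zs"]
        by (simp add: dist_norm)
      also have "\<dots> \<le> Llx * R + norm (?G zs)"
        using R[OF z] L by (simp add: dist_commute mult_left_mono)
      finally show ?thesis by (simp add: mult_right_mono)
    qed
    ultimately show ?thesis using s(3)[OF z] by (simp add: payoff_def)
  qed
  then show ?thesis by (auto intro!: bdd_belowI2)
qed

lemma payoff_le_primal: "z \<in> X \<Longrightarrow> v \<in> \<Lambda> \<Longrightarrow> payoff z v - \<rho> * \<omega> v \<le> primal \<rho> z"
  unfolding primal_def using bdd_above_payoff by (intro cSUP_upper)

lemma dual_le_payoff: "z \<in> X \<Longrightarrow> v \<in> \<Lambda> \<Longrightarrow> dual v \<le> payoff z v"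
  unfolding dual_def using bdd_below_payoff by (intro cINF_lower)

lemma le_dual: "(\<And>z. z \<in> X \<Longrightarrow> c \<le> payoff z v) \<Longrightarrow> c \<le> dual v"
  unfolding dual_def using X(3) by (intro cINF_greatest)

text \<open>The midpoint of \<open>u\<close> and \<open>v\<close> has value at most the supremum, and strong concavity puts it
  \<open>\<rho> / 8 \<cdot> \<parallel>u - v\<parallel>\<^sup>2\<close> above the mean of the values at \<open>u\<close> and \<open>v\<close>.\<close>

lemma near_maximizer_growth:
  assumes z: "z \<in> X" and uv: "u \<in> \<Lambda>" "v \<in> \<Lambda>" and "\<rho> \<ge> 0"
    and near: "primal \<rho> z \<le> payoff z u - \<rho> * \<omega> u + e"
  shows "payoff z v - \<rho> * \<omega> v \<le> primal \<rho> z + e - \<rho> / 4 * (norm (u - v))\<^sup>2"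
proof -
  define m where "m = (1/2) *\<^sub>R u + (1/2) *\<^sub>R v"
  have m: "m \<in> \<Lambda>" using convexD[OF \<Lambda>(1) uv, of "1/2" "1/2"] by (simp add: m_def)
  have "\<rho> * (\<omega> m + 1 / 8 * (norm (u - v))\<^sup>2) \<le> \<rho> * ((\<omega> u + \<omega> v) / 2)"
    using \<omega>(1) uv \<open>\<rho> \<ge> 0\<close> unfolding midpoint_strongly_convex_on_def m_def
    by (intro mult_left_mono) auto
  moreover have "q m \<le> (q u + q v) / 2"
    using convex_onD[OF q, of "1/2" u v] uv by (simp add: m_def)
  moreover have "(\<Phi> z u + \<Phi> z v) / 2 \<le> \<Phi> z m"
    using concave_onD[OF \<Phi>_concave, of "1/2" u v z] by (simp add: m_def)
  moreover have "payoff z m - \<rho> * \<omega> m \<le> primal \<rho> z" by (rule payoff_le_primal[OF z m])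
  ultimately show ?thesis using near by (simp add: payoff_def field_simps)
qed

lemma near_minimizer_growth:
  assumes xz: "x \<in> X" "z \<in> X" and near: "\<And>z. z \<in> X \<Longrightarrow> p x + \<Phi> x v \<le> p z + \<Phi> z v + e"
  shows "p x + \<Phi> x v - 2 * e + \<mu> / 4 * (norm (x - z))\<^sup>2 \<le> p z + \<Phi> z v"
proof -
  define m where "m = (1/2) *\<^sub>R x + (1/2) *\<^sub>R z"
  have m: "m \<in> X" using convexD[OF X(1) xz, of "1/2" "1/2"] by (simp add: m_def)
  have "p m + \<mu> / 8 * (norm (x - z))\<^sup>2 \<le> (p x + p z) / 2"
    using p(2) xz unfolding midpoint_strongly_convex_on_def m_def by auto
  moreover have "\<Phi> m v \<le> (\<Phi> x v + \<Phi> z v) / 2"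
    using convex_onD[OF \<Phi>_convex, of "1/2" x z v] by (simp add: m_def)
  ultimately show ?thesis using near[OF m] by (simp add: field_simps)
qed

text \<open>At an \<open>e\<close>-minimizer \<open>x\<close> for the dual point \<open>v\<close>, linearizing in the dual variable minorizes the
  dual function up to \<open>2 e\<close> and a quadratic term. The minorant has to hold against every
  competitor \<open>z\<close>, whose own slope differs from that of \<open>x\<close> by at most \<open>Llx \<cdot> \<parallel>x - z\<parallel>\<close>; the
  quadratic growth of the payoff away from \<open>x\<close> pays for this difference.\<close>

lemma dual_inexact_oracle:
  assumes x: "x \<in> X" and v: "v \<in> \<Lambda>" "v' \<in> \<Lambda>" and z: "z \<in> X"
    and near: "\<And>z. z \<in> X \<Longrightarrow> p x + \<Phi> x v \<le> p z + \<Phi> z v + e"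
  shows "p x + \<Phi> x v + grad (\<Phi> x) v (v' - v) - 2 * e
           - (Lll + Llx\<^sup>2 / \<mu>) * (norm (v' - v))\<^sup>2 \<le> p z + \<Phi> z v'"
proof -
  define r d where "r = norm (x - z)" and "d = norm (v' - v)"
  have "p x + \<Phi> x v - 2 * e + \<mu> / 4 * r\<^sup>2 \<le> p z + \<Phi> z v"
    unfolding r_def using x z near by (rule near_minimizer_growth)
  moreover have "\<Phi> z v + grad (\<Phi> z) v (v' - v) - Lll / 2 * d\<^sup>2 \<le> \<Phi> z v'"
    unfolding d_def using \<Lambda>(1) v \<Phi>_diff2 \<Phi>_ll[OF z] by (rule lipschitz_grad_lower_bound)
  moreover have "grad (\<Phi> x) v (v' - v) - Llx * r * d \<le> grad (\<Phi> z) v (v' - v)"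
  proof -
    have "(grad (\<Phi> x) v - grad (\<Phi> z) v) (v' - v) \<le> norm (grad (\<Phi> x) v - grad (\<Phi> z) v) * d"
      using norm_blinfun[of "grad (\<Phi> x) v - grad (\<Phi> z) v" "v' - v"] by (simp add: d_def)
    also have "\<dots> \<le> Llx * r * d"
      using lipschitz_onD[OF \<Phi>_lx[OF v(1)] x z]
      by (intro mult_right_mono) (auto simp: d_def r_def dist_norm)
    finally show ?thesis by (simp add: blinfun.diff_left)
  qed
  moreover have "0 \<le> \<mu> / 4 * r\<^sup>2 - Llx * r * d + Llx\<^sup>2 / \<mu> * d\<^sup>2"
  proof -
    have "\<mu> / 4 * r\<^sup>2 - Llx * r * d + Llx\<^sup>2 / \<mu> * d\<^sup>2 = \<mu> / 4 * (r - 2 * Llx * d / \<mu>)\<^sup>2"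
      using p(3) by (simp add: power2_eq_square field_simps)
    moreover have "0 \<le> \<mu> / 4 * (r - 2 * Llx * d / \<mu>)\<^sup>2" using p(3) by simp
    ultimately show ?thesis by linarith
  qed
  moreover have "0 \<le> Lll / 2 * d\<^sup>2" using lipschitz_on_nonneg[OF \<Phi>_ll[OF z]] by simp
  ultimately show ?thesis unfolding d_def[symmetric] ring_distribs by linarith
qed

text \<open>The new primal value is estimated by convexity in \<open>x\<close>, evaluated at the near-maximizer \<open>lu\<close>
  itself: the old part is bounded by the growth around \<open>lt\<close>, the new part by the tangent \<open>T\<close> of
  \<open>\<Phi> xt\<close> at \<open>lh\<close>. The new dual value is bounded below by the inexact oracle at \<open>lh\<close>. The
  displacement \<open>l' - lh\<close> equals \<open>(1 - \<tau>) (lu - lt)\<close>, so the oracle's quadratic loss is absorbed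
  by the growth term exactly under the stated condition on \<open>\<tau>\<close> and \<open>\<rho>\<close>, and the two copies of
  \<open>(1 - \<tau>) T\<close> cancel.\<close>

lemma gap_step:
  assumes mem: "x \<in> X" "xt \<in> X" "l \<in> \<Lambda>" "lt \<in> \<Lambda>" "lu \<in> \<Lambda>"
    and \<tau>: "0 \<le> \<tau>" "\<tau> \<le> 1" and \<rho>: "0 \<le> \<rho>" "4 * (Lll + Llx\<^sup>2 / \<mu>) * (1 - \<tau>)\<^sup>2 \<le> \<tau> * \<rho>"
    and lh: "lh = \<tau> *\<^sub>R l + (1 - \<tau>) *\<^sub>R lt" and x': "x' = \<tau> *\<^sub>R x + (1 - \<tau>) *\<^sub>R xt"
    and l': "l' = \<tau> *\<^sub>R l + (1 - \<tau>) *\<^sub>R lu"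
    and e1: "primal \<rho> x \<le> payoff x lt - \<rho> * \<omega> lt + e1"
    and e2: "payoff xt lh \<le> dual lh + e2"
    and e3: "primal (\<tau> * \<rho>) x' \<le> payoff x' lu - \<tau> * \<rho> * \<omega> lu + e3"
  shows "primal (\<tau> * \<rho>) x' - dual l' \<le> \<tau> * (primal \<rho> x - dual l) + (\<tau> * e1 + 2 * e2 + e3)"
proof -
  define LD r where "LD = Lll + Llx\<^sup>2 / \<mu>" and "r = norm (lt - lu)"
  have lh_mem: "lh \<in> \<Lambda>" and l'_mem: "l' \<in> \<Lambda>"
    using \<Lambda>(1) mem \<tau> by (auto simp: lh l' intro!: convexD)
  define T where "T = p xt + \<Phi> xt lh + grad (\<Phi> xt) lh (lu - lh) - q lu"
  have "primal (\<tau> * \<rho>) x' \<le> \<tau> * (primal \<rho> x + e1 - \<rho> / 4 * r\<^sup>2) + (1 - \<tau>) * T + e3"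
  proof -
    have "p x' \<le> \<tau> * p x + (1 - \<tau>) * p xt"
      using convex_onD[OF p(1), of "1 - \<tau>" x xt] mem \<tau> by (simp add: x')
    moreover have "\<Phi> x' lu \<le> \<tau> * \<Phi> x lu + (1 - \<tau>) * \<Phi> xt lu"
      using convex_onD[OF \<Phi>_convex, of "1 - \<tau>" x xt lu] \<tau> by (simp add: x')
    ultimately have "payoff x' lu - \<tau> * \<rho> * \<omega> lu
        \<le> \<tau> * (payoff x lu - \<rho> * \<omega> lu) + (1 - \<tau>) * payoff xt lu"
      by (simp add: payoff_def algebra_simps)
    also have "\<dots> \<le> \<tau> * (primal \<rho> x + e1 - \<rho> / 4 * r\<^sup>2) + (1 - \<tau>) * T"
    proof (intro add_mono mult_left_mono)
      show "payoff x lu - \<rho> * \<omega> lu \<le> primal \<rho> x + e1 - \<rho> / 4 * r\<^sup>2"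
        unfolding r_def using mem(1,4,5) \<rho>(1) e1 by (rule near_maximizer_growth)
      show "payoff xt lu \<le> T"
        using concave_below_tangent[of xt lu lh] by (simp add: payoff_def T_def)
    qed (use \<tau> in auto)
    finally show ?thesis using e3 by linarith
  qed
  moreover have "\<tau> * dual l + (1 - \<tau>) * T - 2 * e2 - LD * ((1 - \<tau>) * r)\<^sup>2 \<le> dual l'"
  proof (rule le_dual)
    fix z assume z: "z \<in> X"
    have near: "p xt + \<Phi> xt lh \<le> p z + \<Phi> z lh + e2" if "z \<in> X" for z
      using e2 dual_le_payoff[OF that lh_mem] by (simp add: payoff_def)
    have "l' - lh = (1 - \<tau>) *\<^sub>R (lu - lt)" by (simp add: l' lh algebra_simps)
    then have norm_eq: "norm (l' - lh) = (1 - \<tau>) * r" using \<tau> by (simp add: r_def norm_minus_commute)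
    define Q where "Q = LD * ((1 - \<tau>) * r)\<^sup>2"
    have "p xt + \<Phi> xt lh + grad (\<Phi> xt) lh (l' - lh) - 2 * e2 - Q \<le> p z + \<Phi> z l'"
      unfolding Q_def LD_def norm_eq[symmetric]
      using mem(2) lh_mem l'_mem z near by (rule dual_inexact_oracle)
    moreover have "grad (\<Phi> xt) lh (l' - lh)
        = \<tau> * grad (\<Phi> xt) lh (l - lh) + (1 - \<tau>) * grad (\<Phi> xt) lh (lu - lh)"
    proof -
      have "l' - lh = \<tau> *\<^sub>R (l - lh) + (1 - \<tau>) *\<^sub>R (lu - lh)" by (simp add: l' algebra_simps)
      then show ?thesis by (simp add: blinfun.add_right blinfun.scaleR_right)
    qed
    moreover have "q l' \<le> \<tau> * q l + (1 - \<tau>) * q lu"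
      using convex_onD[OF q, of "1 - \<tau>" l lu] mem \<tau> by (simp add: l')
    moreover have "\<tau> * dual l \<le> \<tau> * (p xt + \<Phi> xt lh + grad (\<Phi> xt) lh (l - lh) - q l)"
      using dual_le_payoff[OF mem(2,3)] concave_below_tangent[of xt l lh] \<tau>
      by (intro mult_left_mono) (auto simp: payoff_def)
    ultimately show "\<tau> * dual l + (1 - \<tau>) * T - 2 * e2 - LD * ((1 - \<tau>) * r)\<^sup>2 \<le> payoff z l'"
      unfolding Q_def[symmetric] by (simp add: payoff_def T_def algebra_simps)
  qed
  moreover have "LD * ((1 - \<tau>) * r)\<^sup>2 \<le> \<tau> * (\<rho> / 4 * r\<^sup>2)"
    using mult_right_mono[OF \<rho>(2)[folded LD_def], of "r\<^sup>2 / 4"] by (simp add: power_mult_distrib mult_ac)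
  ultimately show ?thesis by (simp add: algebra_simps)
qed

text \<open>The weight \<open>(k + 1) (k + 2)\<close> turns the factor \<open>\<tau> k\<close> of the recursion into \<open>1\<close>. The closed form
  of \<open>\<rho>\<close> and the feasibility of the iterates are carried along because every step needs them.\<close>

lemma accumulated_gap:
  fixes x xt :: "nat \<Rightarrow> 'a" and l lh lt lu :: "nat \<Rightarrow> 'b" and e1 e2 e3 \<rho> \<tau> :: "nat \<Rightarrow> real"
  defines "LD \<equiv> Lll + Llx\<^sup>2 / \<mu>"
  assumes start: "x 0 \<in> X" "l 0 \<in> \<Lambda>" and LD: "LD \<ge> 0" and \<rho>0: "\<rho> 0 = 8 * LD"
    and \<tau>: "\<And>k. \<tau> k = (real k + 1) / (real k + 3)"
    and mem: "\<And>k. k < K \<Longrightarrow> xt k \<in> X" "\<And>k. k < K \<Longrightarrow> lt k \<in> \<Lambda>" "\<And>k. k < K \<Longrightarrow> lu k \<in> \<Lambda>"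
    and \<rho>_Suc: "\<And>k. k < K \<Longrightarrow> \<rho> (Suc k) = \<tau> k * \<rho> k"
    and lh: "\<And>k. k < K \<Longrightarrow> lh k = \<tau> k *\<^sub>R l k + (1 - \<tau> k) *\<^sub>R lt k"
    and x_Suc: "\<And>k. k < K \<Longrightarrow> x (Suc k) = \<tau> k *\<^sub>R x k + (1 - \<tau> k) *\<^sub>R xt k"
    and l_Suc: "\<And>k. k < K \<Longrightarrow> l (Suc k) = \<tau> k *\<^sub>R l k + (1 - \<tau> k) *\<^sub>R lu k"
    and e1: "\<And>k. k < K \<Longrightarrow> primal (\<rho> k) (x k) \<le> payoff (x k) (lt k) - \<rho> k * \<omega> (lt k) + e1 k"
    and e2: "\<And>k. k < K \<Longrightarrow> payoff (xt k) (lh k) \<le> dual (lh k) + e2 k"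
    and e3: "\<And>k. k < K \<Longrightarrow> primal (\<rho> (Suc k)) (x (Suc k))
               \<le> payoff (x (Suc k)) (lu k) - \<rho> (Suc k) * \<omega> (lu k) + e3 k"
    and n: "n \<le> K"
  shows "(real n + 1) * (real n + 2) * (primal (\<rho> n) (x n) - dual (l n))
           \<le> 2 * (primal (\<rho> 0) (x 0) - dual (l 0))
             + (\<Sum>k<n. (real k + 2) * (real k + 3) * (\<tau> k * e1 k + 2 * e2 k + e3 k))
         \<and> \<rho> n = 16 * LD / ((real n + 1) * (real n + 2)) \<and> x n \<in> X \<and> l n \<in> \<Lambda>"
  using n
proof (induction n)
  case 0
  then show ?case using start \<rho>0 by simp
next
  case (Suc k)
  define gap' where "gap' n = primal (\<rho> n) (x n) - dual (l n)" for n
  have k: "k < K" using Suc.prems by simp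
  have IH: "(real k + 1) * (real k + 2) * gap' k \<le> 2 * gap' 0
      + (\<Sum>k<k. (real k + 2) * (real k + 3) * (\<tau> k * e1 k + 2 * e2 k + e3 k))"
    and \<rho>k: "\<rho> k = 16 * LD / ((real k + 1) * (real k + 2))" and xk: "x k \<in> X" and lk: "l k \<in> \<Lambda>"
    using Suc by (auto simp: gap'_def)
  have \<tau>01: "0 \<le> \<tau> k" "\<tau> k \<le> 1" and \<tau>': "1 - \<tau> k = 2 / (real k + 3)"
    by (simp_all add: \<tau> field_simps)
  have \<rho>': "\<tau> k * \<rho> k = 16 * LD / ((real k + 2) * (real k + 3))"
    unfolding \<rho>k \<tau> by (simp add: divide_simps)
  have "gap' (Suc k) \<le> \<tau> k * gap' k + (\<tau> k * e1 k + 2 * e2 k + e3 k)"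
    unfolding gap'_def \<rho>_Suc[OF k]
  proof (rule gap_step[OF xk mem(1)[OF k] lk mem(2,3)[OF k] \<tau>01 _ _ lh[OF k] x_Suc[OF k] l_Suc[OF k]
        e1[OF k] e2[OF k] e3[OF k, unfolded \<rho>_Suc[OF k]]])
    show "\<rho> k \<ge> 0" using LD by (simp add: \<rho>k)
    show "4 * (Lll + Llx\<^sup>2 / \<mu>) * (1 - \<tau> k)\<^sup>2 \<le> \<tau> k * \<rho> k"
      unfolding LD_def[symmetric] \<tau>' \<rho>' using LD
      by (simp add: power2_eq_square divide_simps) (simp add: algebra_simps mult_nonneg_nonneg)
  qed
  then have "(real k + 2) * (real k + 3) * gap' (Suc k)
      \<le> (real k + 2) * (real k + 3) * (\<tau> k * gap' k + (\<tau> k * e1 k + 2 * e2 k + e3 k))"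
    by (intro mult_left_mono) auto
  moreover have "(real k + 2) * (real k + 3) * (\<tau> k * gap' k) = (real k + 1) * (real k + 2) * gap' k"
    by (simp add: \<tau> divide_simps)
  ultimately have Suc_le: "(real k + 2) * (real k + 3) * gap' (Suc k) \<le> 2 * gap' 0
      + (\<Sum>k<Suc k. (real k + 2) * (real k + 3) * (\<tau> k * e1 k + 2 * e2 k + e3 k))"
    using IH unfolding sum.lessThan_Suc distrib_left[of _ "\<tau> k * gap' k"] by linarith
  moreover have "x (Suc k) \<in> X" "l (Suc k) \<in> \<Lambda>"
    unfolding x_Suc[OF k] l_Suc[OF k]
    using X(1) \<Lambda>(1) xk lk mem[OF k] \<tau>01 by (auto intro!: convexD)
  ultimately show ?case
    using Suc_le \<rho>' \<rho>_Suc[OF k] by (simp add: gap'_def add.commute add.left_commute)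
qed

end

section \<open>Measurability of the primal and dual functions\<close>

text \<open>Sublevel sets are sections of the closed epigraph.\<close>

lemma borel_measurable_if_closed_convex_proper:
  fixes f :: "'a::real_normed_vector \<Rightarrow> ereal"
  assumes "closed_convex_proper f"
  shows "f \<in> borel_measurable borel"
proof -
  have "closed {z. f z \<le> ereal r}" for r
  proof -
    have "closed ((\<lambda>z. (z, r)) -` eepi f)"
      using assms unfolding closed_convex_proper_def
      by (intro closed_vimage continuous_intros) auto
    then show ?thesis by (simp add: eepi_def vimage_def)
  qed
  then have le_real: "{z. f z \<le> ereal r} \<in> sets borel" for r by auto
  show ?thesis
  proof (rule borel_measurableI_le)
    fix y :: ereal
    show "{z \<in> space borel. f z \<le> y} \<in> sets borel"
    proof (cases y)
      case MInf
      then have "{z. f z \<le> y} = {}"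
        using assms by (auto simp: closed_convex_proper_def proper_fun_def)
      then show ?thesis by simp
    next
      case (real r)
      then show ?thesis using le_real[of r] by simp
    qed simp
  qed
qed

text \<open>Approximate \<open>u\<close> pointwise by simple functions. For a simple first argument the claim reduces to
  countably many fixed values, and continuity in the first argument passes it to the limit.\<close>

lemma borel_measurable_Caratheodory:
  fixes \<Phi> :: "'a::{metric_space, second_countable_topology} \<Rightarrow> 'b::topological_space \<Rightarrow> real"
  assumes u: "u \<in> borel_measurable M" and v: "v \<in> borel_measurable M"
    and c1: "\<And>b. continuous_on UNIV (\<lambda>a. \<Phi> a b)" and c2: "\<And>a. continuous_on UNIV (\<Phi> a)"
  shows "(\<lambda>w. \<Phi> (u w) (v w)) \<in> borel_measurable M"
proof -
  obtain s where s: "\<And>i. simple_function M (s i)" "\<And>w. w \<in> space M \<Longrightarrow> (\<lambda>i. s i w) \<longlonglongrightarrow> u w"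
    using borel_measurable_implies_sequence_metric[OF u] by blast
  have "(\<lambda>w. \<Phi> (s i w) (v w)) \<in> borel_measurable M" for i
  proof (rule measurable_compose_countable'[where I = "s i ` space M"])
    show "(\<lambda>w. \<Phi> a (v w)) \<in> borel_measurable M" for a
      using v borel_measurable_continuous_onI[OF c2] by (rule measurable_compose)
    show "s i \<in> M \<rightarrow>\<^sub>M count_space (s i ` space M)"
      using s(1) by (simp add: simple_function_def measurable_count_space_eq2)
    show "countable (s i ` space M)"
      using s(1) by (simp add: simple_function_def countable_finite)
  qed
  moreover have "(\<lambda>i. \<Phi> (s i w) (v w)) \<longlonglongrightarrow> \<Phi> (u w) (v w)" if "w \<in> space M" for w
    using continuous_on_tendsto_compose[OF c1 s(2)[OF that]] by simp
  ultimately show ?thesis by (rule borel_measurable_LIMSEQ_real[rotated])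
qed

text \<open>The index set may be uncountable: a supremum of continuous functions has open strict
  superlevel sets.\<close>

lemma borel_measurable_SUP_continuous:
  fixes F :: "'i \<Rightarrow> 'a::topological_space \<Rightarrow> ereal"
  assumes "\<And>i. i \<in> I \<Longrightarrow> continuous_on UNIV (F i)"
  shows "(\<lambda>a. SUP i\<in>I. F i a) \<in> borel_measurable borel"
proof (rule borel_measurableI_greater)
  fix y :: ereal
  have "{a. y < (SUP i\<in>I. F i a)} = (\<Union>i\<in>I. {a. y < F i a})" by (auto simp: less_SUP_iff)
  moreover have "open (\<Union>i\<in>I. {a. y < F i a})"
    using assms by (intro open_UN ballI open_Collect_less continuous_intros)
  ultimately show "{a \<in> space borel. y < (SUP i\<in>I. F i a)} \<in> sets borel" by simp
qed

lemma borel_measurable_INF_continuous: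
  fixes F :: "'i \<Rightarrow> 'a::topological_space \<Rightarrow> ereal"
  assumes "\<And>i. i \<in> I \<Longrightarrow> continuous_on UNIV (F i)"
  shows "(\<lambda>a. INF i\<in>I. F i a) \<in> borel_measurable borel"
proof (rule borel_measurableI_less)
  fix y :: ereal
  have "{a. (INF i\<in>I. F i a) < y} = (\<Union>i\<in>I. {a. F i a < y})" by (auto simp: INF_less_iff)
  moreover have "open (\<Union>i\<in>I. {a. F i a < y})"
    using assms by (intro open_UN ballI open_Collect_less continuous_intros)
  ultimately show "{a \<in> space borel. (INF i\<in>I. F i a) < y} \<in> sets borel" by simp
qed

context smooth_saddle_problem
begin

lemma \<Phi>_continuous1: "continuous_on UNIV (\<lambda>z. \<Phi> z v)"
  using \<Phi>_diff1 differentiable_imp_continuous_within by (metis continuous_at_imp_continuous_on)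

lemma \<Phi>_continuous2: "continuous_on UNIV (\<Phi> z)"
  using \<Phi>_diff2 differentiable_imp_continuous_within by (metis continuous_at_imp_continuous_on)

lemma primal_le: "(\<And>v. v \<in> \<Lambda> \<Longrightarrow> payoff z v - \<rho> * \<omega> v \<le> c) \<Longrightarrow> primal \<rho> z \<le> c"
  unfolding primal_def using \<Lambda>(3) by (intro cSUP_least)

text \<open>Both the extended-real primal function (\<open>c = 0\<close>) and the supremum stripped of its
  discontinuous part \<open>p z\<close> (\<open>c = - p z\<close>) are instances.\<close>

lemma SUP_ereal_payoff:
  assumes z: "z \<in> X"
  shows "(SUP v\<in>\<Lambda>. ereal (payoff z v - \<rho> * \<omega> v + c)) = ereal (primal \<rho> z + c)"
proof (rule SUP_eqI)
  show "ereal (payoff z v - \<rho> * \<omega> v + c) \<le> ereal (primal \<rho> z + c)" if "v \<in> \<Lambda>" for v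
    using payoff_le_primal[OF z that] by simp
  fix y assume y: "\<And>v. v \<in> \<Lambda> \<Longrightarrow> ereal (payoff z v - \<rho> * \<omega> v + c) \<le> y"
  show "ereal (primal \<rho> z + c) \<le> y"
  proof (cases y)
    case (real r)
    have "primal \<rho> z \<le> r - c" using y real by (intro primal_le) (force simp: algebra_simps)
    then show ?thesis using real by simp
  next
    case MInf
    then show ?thesis using y \<Lambda>(3) by auto
  qed simp
qed

lemma INF_ereal_payoff:
  assumes v: "v \<in> \<Lambda>"
  shows "(INF z\<in>X. ereal (payoff z v + c)) = ereal (dual v + c)"
proof (rule INF_eqI)
  show "ereal (dual v + c) \<le> ereal (payoff z v + c)" if "z \<in> X" for z
    using dual_le_payoff[OF that v] by simp
  fix y assume y: "\<And>z. z \<in> X \<Longrightarrow> y \<le> ereal (payoff z v + c)"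
  show "y \<le> ereal (dual v + c)"
  proof (cases y)
    case (real r)
    have "r - c \<le> dual v" using y real by (intro le_dual) (force simp: algebra_simps)
    then show ?thesis using real by simp
  next
    case PInf
    then show ?thesis using y X(3) by auto
  qed simp
qed

text \<open>Split off \<open>p\<close>: the remaining supremum is over functions continuous in \<open>z\<close>.\<close>

lemma borel_measurable_primal:
  assumes u: "u \<in> borel_measurable N" "\<And>w. w \<in> space N \<Longrightarrow> u w \<in> X"
    and pu: "(\<lambda>w. p (u w)) \<in> borel_measurable N"
  shows "(\<lambda>w. primal \<rho> (u w)) \<in> borel_measurable N"
proof -
  define s where "s z = (SUP v\<in>\<Lambda>. ereal (\<Phi> z v - q v - \<rho> * \<omega> v))" for z
  have "s \<in> borel_measurable borel"
    unfolding s_def using \<Phi>_continuous1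
    by (intro borel_measurable_SUP_continuous continuous_intros) auto
  then have "(\<lambda>w. p (u w) + real_of_ereal (s (u w))) \<in> borel_measurable N"
    using u(1) pu by measurable
  moreover have "p (u w) + real_of_ereal (s (u w)) = primal \<rho> (u w)" if "w \<in> space N" for w
    using SUP_ereal_payoff[OF u(2)[OF that], of \<rho> "- p (u w)"]
    by (simp add: s_def payoff_def algebra_simps)
  ultimately show ?thesis by (simp cong: measurable_cong)
qed

lemma borel_measurable_dual:
  assumes u: "u \<in> borel_measurable N" "\<And>w. w \<in> space N \<Longrightarrow> u w \<in> \<Lambda>"
    and qu: "(\<lambda>w. q (u w)) \<in> borel_measurable N"
  shows "(\<lambda>w. dual (u w)) \<in> borel_measurable N"
proof -
  define s where "s v = (INF z\<in>X. ereal (p z + \<Phi> z v))" for v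
  have "s \<in> borel_measurable borel"
    unfolding s_def using \<Phi>_continuous2
    by (intro borel_measurable_INF_continuous continuous_intros) auto
  then have "(\<lambda>w. real_of_ereal (s (u w)) - q (u w)) \<in> borel_measurable N"
    using u(1) qu by measurable
  moreover have "real_of_ereal (s (u w)) - q (u w) = dual (u w)" if "w \<in> space N" for w
    using INF_ereal_payoff[OF u(2)[OF that], of "q (u w)"]
    by (simp add: s_def payoff_def algebra_simps)
  ultimately show ?thesis by (simp cong: measurable_cong)
qed

lemma primal_diff_le:
  assumes z: "z \<in> X"
  shows "primal \<rho> z \<le> primal \<rho>' z + \<bar>\<rho> - \<rho>'\<bar> * B\<omega>"
proof (rule primal_le)
  fix v assume v: "v \<in> \<Lambda>"
  have "(\<rho>' - \<rho>) * \<omega> v \<le> \<bar>\<rho> - \<rho>'\<bar> * \<bar>\<omega> v\<bar>"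
    by (metis abs_ge_self abs_minus_commute abs_mult)
  also have "\<dots> \<le> \<bar>\<rho> - \<rho>'\<bar> * B\<omega>" using \<omega>(2)[OF v] by (intro mult_left_mono) auto
  finally show "payoff z v - \<rho> * \<omega> v \<le> primal \<rho>' z + \<bar>\<rho> - \<rho>'\<bar> * B\<omega>"
    using payoff_le_primal[OF z v, of \<rho>'] by (simp add: algebra_simps)
qed

end

section \<open>From conditional expectations to tail bounds\<close>

lemma join_sigma_subalgebra:
  assumes F: "subalgebra M F" and Y: "Y \<in> borel_measurable M"
  shows "subalgebra M (join_sigma F Y)"
proof -
  have sp: "space F = space M" and sub: "sets F \<subseteq> sets M" using F by (auto simp: subalgebra_def)
  have "sets F \<union> {Y -` A \<inter> space F |A. A \<in> sets borel} \<subseteq> sets M"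
    using sub measurable_sets[OF Y] sp by auto
  moreover from this have "sets F \<union> {Y -` A \<inter> space F |A. A \<in> sets borel} \<subseteq> Pow (space F)"
    using sets.space_closed[of M] sp by blast
  ultimately show ?thesis
    unfolding subalgebra_def join_sigma_def
    using sets.sigma_sets_subset[of "sets F \<union> {Y -` A \<inter> space F |A. A \<in> sets borel}" M]
    by (simp only: space_measure_of_conv sets_measure_of sp simp_thms)
qed

lemma (in prob_space) nn_integral_le_if_nn_cond_exp_le:
  assumes sub: "subalgebra M F" and g: "g \<in> borel_measurable M"
    and le: "AE w in M. nn_cond_exp M F g w \<le> c"
  shows "(\<integral>\<^sup>+ w. g w \<partial>M) \<le> c"
proof -
  interpret sigma_finite_subalgebra M F
    using sub finite_measure_axioms
    by (simp add: finite_measure_subalgebra_is_sigma_finite finite_measure_subalgebra_def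
        finite_measure_subalgebra_axioms_def)
  have "(\<integral>\<^sup>+ w. g w \<partial>M) = (\<integral>\<^sup>+ w. nn_cond_exp M F g w \<partial>M)"
    using nn_cond_exp_intg[OF _ g, of "\<lambda>_. 1"] by simp
  also have "\<dots> \<le> (\<integral>\<^sup>+ w. c \<partial>M)" using le by (rule nn_integral_mono_AE)
  also have "\<dots> = c" by (simp add: emeasure_space_1)
  finally show ?thesis .
qed

text \<open>Stated for an event \<open>E\<close> that contains \<open>{T \<le> c}\<close>, so that the deterministic analysis can be
  plugged in directly.\<close>

lemma (in prob_space) prob_ge_by_Markov:
  fixes T :: "'a \<Rightarrow> real"
  assumes T: "T \<in> borel_measurable M" "(\<integral>\<^sup>+ w. ennreal (T w) \<partial>M) \<le> ennreal (\<delta> * c)" and c: "c > 0" "\<delta> \<ge> 0"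
    and E: "E \<in> sets M" "\<And>w. w \<in> space M \<Longrightarrow> T w \<le> c \<Longrightarrow> w \<in> E"
  shows "1 - \<delta> \<le> prob E"
proof -
  let ?B = "{w\<in>space M. 1 \<le> ennreal (1 / c) * ennreal (T w)}"
  have B: "?B \<in> events" using T(1) by measurable
  have "emeasure M ?B \<le> ennreal (1 / c) * (\<integral>\<^sup>+ w. ennreal (T w) * indicator (space M) w \<partial>M)"
    using T(1) by (intro nn_integral_Markov_inequality) auto
  also have "\<dots> \<le> ennreal (1 / c) * ennreal (\<delta> * c)"
    using T(2) by (intro mult_left_mono) (simp_all cong: nn_integral_cong_simp)
  also have "\<dots> = ennreal \<delta>" using c by (simp add: ennreal_mult[symmetric])
  finally have "prob ?B \<le> \<delta>" using c by (simp add: emeasure_eq_measure)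
  moreover have "space M - ?B \<subseteq> E"
  proof
    fix w assume w: "w \<in> space M - ?B"
    have "T w \<le> c"
    proof (rule ccontr)
      assume "\<not> T w \<le> c"
      then have "1 \<le> 1 / c * T w" using c by (simp add: field_simps)
      then have "1 \<le> ennreal (1 / c) * ennreal (T w)"
        using c \<open>\<not> T w \<le> c\<close> by (subst ennreal_mult[symmetric]) auto
      then show False using w by simp
    qed
    then show "w \<in> E" using E(2) w by simp
  qed
  then have "prob (space M - ?B) \<le> prob E" using E(1) by (intro finite_measure_mono)
  ultimately show ?thesis using prob_compl[OF B] by simp
qed

lemma (in prob_space) nn_integral_weighted_errors_le:
  fixes e1 e2 e3 :: "'a \<Rightarrow> real"
  assumes [measurable]: "e1 \<in> borel_measurable M" "e2 \<in> borel_measurable M" "e3 \<in> borel_measurable M"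
    and nonneg: "\<And>w. w \<in> space M \<Longrightarrow> 0 \<le> e1 w" "\<And>w. w \<in> space M \<Longrightarrow> 0 \<le> e2 w"
      "\<And>w. w \<in> space M \<Longrightarrow> 0 \<le> e3 w"
    and le: "(\<integral>\<^sup>+ w. ennreal (e1 w) \<partial>M) \<le> ennreal b" "(\<integral>\<^sup>+ w. ennreal (e2 w) \<partial>M) \<le> ennreal b"
      "(\<integral>\<^sup>+ w. ennreal (e3 w) \<partial>M) \<le> ennreal b"
    and coeffs: "0 \<le> c1" "0 \<le> c2" "0 \<le> c3" "0 \<le> b"
  shows "(\<integral>\<^sup>+ w. ennreal (c1 * e1 w + c2 * e2 w + c3 * e3 w) \<partial>M) \<le> ennreal ((c1 + c2 + c3) * b)"
proof -
  have "(\<integral>\<^sup>+ w. ennreal (c1 * e1 w + c2 * e2 w + c3 * e3 w) \<partial>M)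
      = (\<integral>\<^sup>+ w. ennreal c1 * ennreal (e1 w) + ennreal c2 * ennreal (e2 w) + ennreal c3 * ennreal (e3 w) \<partial>M)"
    using nonneg coeffs by (intro nn_integral_cong) (simp add: ennreal_mult ennreal_plus)
  also have "\<dots> = ennreal c1 * (\<integral>\<^sup>+ w. ennreal (e1 w) \<partial>M) + ennreal c2 * (\<integral>\<^sup>+ w. ennreal (e2 w) \<partial>M)
      + ennreal c3 * (\<integral>\<^sup>+ w. ennreal (e3 w) \<partial>M)"
    by (simp add: nn_integral_add nn_integral_cmult)
  also have "\<dots> \<le> ennreal c1 * ennreal b + ennreal c2 * ennreal b + ennreal c3 * ennreal b"
    using le by (intro add_mono mult_left_mono) auto
  also have "\<dots> = ennreal ((c1 + c2 + c3) * b)"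
    using coeffs by (simp add: ennreal_mult[symmetric] ennreal_plus[symmetric] distrib_right del: ennreal_plus)
  finally show ?thesis .
qed

lemma (in prob_space) nn_integral_sum_le:
  fixes T :: "'i \<Rightarrow> 'a \<Rightarrow> real"
  assumes "\<And>i. i \<in> I \<Longrightarrow> T i \<in> borel_measurable M"
    and "\<And>i w. i \<in> I \<Longrightarrow> w \<in> space M \<Longrightarrow> 0 \<le> T i w"
    and "\<And>i. i \<in> I \<Longrightarrow> (\<integral>\<^sup>+ w. ennreal (T i w) \<partial>M) \<le> ennreal (b i)" "\<And>i. i \<in> I \<Longrightarrow> 0 \<le> b i"
  shows "(\<integral>\<^sup>+ w. ennreal (\<Sum>i\<in>I. T i w) \<partial>M) \<le> ennreal (\<Sum>i\<in>I. b i)"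
proof -
  have "(\<integral>\<^sup>+ w. ennreal (\<Sum>i\<in>I. T i w) \<partial>M) = (\<integral>\<^sup>+ w. (\<Sum>i\<in>I. ennreal (T i w)) \<partial>M)"
    using assms(2) by (intro nn_integral_cong) (simp add: sum_ennreal)
  also have "\<dots> = (\<Sum>i\<in>I. \<integral>\<^sup>+ w. ennreal (T i w) \<partial>M)"
    using assms(1) by (intro nn_integral_sum) auto
  also have "\<dots> \<le> (\<Sum>i\<in>I. ennreal (b i))" using assms(3) by (rule sum_mono)
  also have "\<dots> = ennreal (\<Sum>i\<in>I. b i)" using assms(4) by (simp add: sum_ennreal)
  finally show ?thesis .
qed

section \<open>The randomized run\<close>

text \<open>Half of \<open>\<epsilon>\<close> is spent on the initial gap and half on the accumulated errors; the slack is
  \<open>(K + 1) (K + 2) - K\<^sup>2 / 2 - K (K + 3) / 2 > 0\<close>.\<close>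

lemma le_of_mult_le_by_iteration_count:
  fixes \<epsilon> G V :: real
  assumes bound: "(real K + 1) * (real K + 2) * G \<le> 2 * V + \<epsilon> * (real K * (real K + 3) / 2)"
    and V: "4 * V \<le> \<epsilon> * (real K)\<^sup>2" and "\<epsilon> > 0"
  shows "G \<le> \<epsilon>"
proof -
  have "(real K + 1) * (real K + 2) * G \<le> \<epsilon> * (real K)\<^sup>2 / 2 + \<epsilon> * (real K * (real K + 3) / 2)"
    using assms(1,2) by linarith
  also have "\<dots> \<le> (real K + 1) * (real K + 2) * \<epsilon>"
    using \<open>\<epsilon> > 0\<close> by (simp add: power2_eq_square field_simps)
  finally show ?thesis by (simp add: mult_le_cancel_left)
qed

text \<open>A run of the algorithm on a problem whose extended-valued data \<open>S\<close> and \<open>\<omega>'\<close> agree on \<open>X\<close> and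
  \<open>\<Lambda>\<close> with the real data of the saddle-point problem.\<close>

locale composite_ipds_run =
  smooth_saddle_problem X \<Lambda> p q \<omega> \<Phi> \<mu> Llx Lll B\<omega> +
  ipds_run M X \<Lambda> S \<omega>' \<delta> K \<rho> \<tau> \<gamma> \<eta> x0 l0 x l lh lt xt lu
  for X :: "'a::fin_dim_normed set" and \<Lambda> :: "'b::fin_dim_normed set" and p q \<omega> \<Phi> \<mu> Llx Lll B\<omega>
    and M :: "'w measure" and S \<omega>' \<delta> K \<rho> \<tau> \<gamma> \<eta> x0 l0 x l lh lt xt lu +
  fixes \<epsilon> LD :: real
  assumes S: "\<And>z v. z \<in> X \<Longrightarrow> v \<in> \<Lambda> \<Longrightarrow> S z v = ereal (p z + \<Phi> z v - q v)"
    and \<omega>': "\<And>v. v \<in> \<Lambda> \<Longrightarrow> \<omega>' v = ereal (\<omega> v)"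
    and meas [measurable]: "p \<in> borel_measurable borel" "q \<in> borel_measurable borel" "\<omega> \<in> borel_measurable borel"
    and LD: "LD = Lll + Llx\<^sup>2 / \<mu>" "LD > 0" and \<epsilon>: "\<epsilon> > 0" and \<delta>: "0 < \<delta>"
    and \<rho>0: "\<rho> 0 = 8 * LD"
    and \<tau>: "\<And>k. \<tau> k = (real k + 1) / (real k + 3)"
    and \<gamma>: "\<And>k. \<gamma> k = \<epsilon> / (4 * (real k + 3))"
    and \<eta>: "\<And>k. \<eta> k = \<epsilon> / (4 * (real k + 3))"
begin

lemma S_payoff: "z \<in> X \<Longrightarrow> v \<in> \<Lambda> \<Longrightarrow> S z v = ereal (payoff z v)"
  by (simp add: S payoff_def)

lemma smoothed_payoff:
  "z \<in> X \<Longrightarrow> v \<in> \<Lambda> \<Longrightarrow> smoothed S \<omega>' r z v = ereal (payoff z v - r * \<omega> v)"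
  by (simp add: S_payoff \<omega>' smoothed_def)

lemma primal_fun_smoothed: "z \<in> X \<Longrightarrow> primal_fun \<Lambda> (smoothed S \<omega>' r) z = ereal (primal r z)"
  using SUP_ereal_payoff[of z r 0] by (simp add: primal_fun_def smoothed_payoff cong: SUP_cong_simp)

lemma primal_fun_S: "z \<in> X \<Longrightarrow> primal_fun \<Lambda> S z = ereal (primal 0 z)"
  using SUP_ereal_payoff[of z 0 0] by (simp add: primal_fun_def S_payoff cong: SUP_cong_simp)

lemma dual_fun_S: "v \<in> \<Lambda> \<Longrightarrow> dual_fun X S v = ereal (dual v)"
  using INF_ereal_payoff[of v 0] by (simp add: dual_fun_def S_payoff cong: INF_cong_simp)

lemma \<tau>_bounds: "0 \<le> \<tau> k" "\<tau> k \<le> 1"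
  by (simp_all add: \<tau> field_simps)

lemma iterates:
  assumes "k \<le> K"
  shows "x k \<in> borel_measurable M" "l k \<in> borel_measurable M"
    and "w \<in> space M \<Longrightarrow> x k w \<in> X" "w \<in> space M \<Longrightarrow> l k w \<in> \<Lambda>"
proof -
  have "x k \<in> borel_measurable M \<and> l k \<in> borel_measurable M
      \<and> (\<forall>w\<in>space M. x k w \<in> X \<and> l k w \<in> \<Lambda>)"
    using assms
  proof (induction k)
    case 0
    have "x 0 \<in> borel_measurable M" by (subst measurable_cong[where g = "\<lambda>_. x0"]) (use start in auto)
    moreover have "l 0 \<in> borel_measurable M"
      by (subst measurable_cong[where g = "\<lambda>_. l0"]) (use start in auto)
    ultimately    show ?case using start start_mem by auto
  next
    case (Suc k)
    then have k: "k < K" and IH: "x k \<in> borel_measurable M" "l k \<in> borel_measurable M"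
      "\<And>w. w \<in> space M \<Longrightarrow> x k w \<in> X" "\<And>w. w \<in> space M \<Longrightarrow> l k w \<in> \<Lambda>" by auto
    have "x (Suc k) \<in> borel_measurable M \<longleftrightarrow> (\<lambda>w. \<tau> k *\<^sub>R x k w + (1 - \<tau> k) *\<^sub>R xt k w) \<in> borel_measurable M"
      "l (Suc k) \<in> borel_measurable M \<longleftrightarrow> (\<lambda>w. \<tau> k *\<^sub>R l k w + (1 - \<tau> k) *\<^sub>R lu k w) \<in> borel_measurable M"
      using step4[OF k] step7[OF k] by (auto intro!: measurable_cong)
    moreover have "x (Suc k) w \<in> X" "l (Suc k) w \<in> \<Lambda>" if "w \<in> space M" for w
      unfolding step4[OF k that] step7[OF k that]
      using X(1) \<Lambda>(1) IH(3,4) that step3_mem[OF k that] step6_mem[OF k that] \<tau>_bounds[of k]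
      by (auto intro!: convexD)
    ultimately show ?case using IH(1,2) step3_rv[OF k] step6_rv[OF k] by auto
  qed
  then show "x k \<in> borel_measurable M" "l k \<in> borel_measurable M"
    and "w \<in> space M \<Longrightarrow> x k w \<in> X" "w \<in> space M \<Longrightarrow> l k w \<in> \<Lambda>" by auto
qed

lemma lh_rv: "k < K \<Longrightarrow> lh k \<in> borel_measurable M"
  using iterates(2)[of k] step1_rv[of k] step2[of k] by (simp cong: measurable_cong)

lemma lh_mem: "k < K \<Longrightarrow> w \<in> space M \<Longrightarrow> lh k w \<in> \<Lambda>"
  using iterates(4)[of k w] step1_mem[of k w] step2[of k w] \<Lambda>(1) \<tau>_bounds[of k]
  by (auto intro!: convexD)

lemma borel_measurable_payoff:
  assumes [measurable]: "u \<in> borel_measurable M" "v \<in> borel_measurable M"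
  shows "(\<lambda>w. payoff (u w) (v w)) \<in> borel_measurable M"
proof -
  have [measurable]: "(\<lambda>w. \<Phi> (u w) (v w)) \<in> borel_measurable M"
    using assms \<Phi>_continuous1 \<Phi>_continuous2 by (rule borel_measurable_Caratheodory)
  show ?thesis unfolding payoff_def by measurable
qed

lemma F0_subalgebra: "k \<le> K \<Longrightarrow> subalgebra M (F0 M lt xt lu k)"
proof (induction k)
  case 0
  then show ?case by (auto simp: subalgebra_def space_measure_of_conv sets_measure_of sigma_sets_empty_eq)
next
  case (Suc k)
  then show ?case
    using step1_rv[of k] step3_rv[of k] step6_rv[of k] by (simp add: join_sigma_subalgebra)
qed

lemma F1_subalgebra: "k < K \<Longrightarrow> subalgebra M (F1 M lt xt lu k)"
  unfolding F1_def by (intro join_sigma_subalgebra F0_subalgebra step1_rv) auto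

lemma F2_subalgebra: "k < K \<Longrightarrow> subalgebra M (F2 M lt xt lu k)"
  unfolding F2_def by (intro join_sigma_subalgebra F1_subalgebra step3_rv) auto

text \<open>The primal solver is called twice per iteration \<open>k\<close>: at the iterate \<open>j = k\<close> with output
  \<open>u = lt\<close>, and at \<open>j = Suc k\<close> with output \<open>u = lu\<close>.\<close>

definition primal_error :: "nat \<Rightarrow> (nat \<Rightarrow> 'w \<Rightarrow> 'b) \<Rightarrow> nat \<Rightarrow> 'w \<Rightarrow> real" where
  "primal_error j u k w = primal (\<rho> j) (x j w) - (payoff (x j w) (u k w) - \<rho> j * \<omega> (u k w))"

definition dual_error :: "nat \<Rightarrow> 'w \<Rightarrow> real" where
  "dual_error k w = payoff (xt k w) (lh k w) - dual (lh k w)"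

text \<open>The conditional expectation of a non-measurable function is \<open>0\<close> by convention, so the solver
  guarantees carry information only because the errors are measurable.\<close>

lemma primal_error:
  assumes j: "j \<le> K" and u: "u k \<in> borel_measurable M" "\<And>w. w \<in> space M \<Longrightarrow> u k w \<in> \<Lambda>"
  shows "primal_error j u k \<in> borel_measurable M" "w \<in> space M \<Longrightarrow> 0 \<le> primal_error j u k w"
    and "w \<in> space M \<Longrightarrow> e2ennreal (primal_fun \<Lambda> (smoothed S \<omega>' (\<rho> j)) (x j w)
           - smoothed S \<omega>' (\<rho> j) (x j w) (u k w)) = ennreal (primal_error j u k w)"
proof -
  note [measurable] = iterates(1)[OF j] u(1)
  note [measurable] = borel_measurable_payoff[OF iterates(1)[OF j] u(1)]
  have [measurable]: "(\<lambda>w. primal (\<rho> j) (x j w)) \<in> borel_measurable M"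
    by (rule borel_measurable_primal) (use iterates(3)[OF j] in auto)
  show "primal_error j u k \<in> borel_measurable M" unfolding primal_error_def by measurable
  show "0 \<le> primal_error j u k w" if "w \<in> space M"
    using payoff_le_primal[OF iterates(3)[OF j that] u(2)[OF that]] by (simp add: primal_error_def)
  show "e2ennreal (primal_fun \<Lambda> (smoothed S \<omega>' (\<rho> j)) (x j w)
           - smoothed S \<omega>' (\<rho> j) (x j w) (u k w)) = ennreal (primal_error j u k w)" if "w \<in> space M"
    using iterates(3)[OF j that] u(2)[OF that]
    by (simp add: primal_fun_smoothed smoothed_payoff primal_error_def e2ennreal_ereal)
qed

lemma dual_error:
  assumes k: "k < K"
  shows "dual_error k \<in> borel_measurable M" "w \<in> space M \<Longrightarrow> 0 \<le> dual_error k w"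
    and "w \<in> space M \<Longrightarrow> e2ennreal (S (xt k w) (lh k w) - dual_fun X S (lh k w)) = ennreal (dual_error k w)"
proof -
  note [measurable] = lh_rv[OF k]
  note [measurable] = borel_measurable_payoff[OF step3_rv[OF k] lh_rv[OF k]]
  have [measurable]: "(\<lambda>w. dual (lh k w)) \<in> borel_measurable M"
    by (rule borel_measurable_dual) (use lh_mem[OF k] in auto)
  show "dual_error k \<in> borel_measurable M" unfolding dual_error_def by measurable
  show "0 \<le> dual_error k w" if "w \<in> space M"
    using dual_le_payoff[OF step3_mem[OF k that] lh_mem[OF k that]] by (simp add: dual_error_def)
  show "e2ennreal (S (xt k w) (lh k w) - dual_fun X S (lh k w)) = ennreal (dual_error k w)" if "w \<in> space M"
    using step3_mem[OF k that] lh_mem[OF k that]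
    by (simp add: S_payoff dual_fun_S dual_error_def e2ennreal_ereal)
qed

lemma nn_integral_error_le:
  assumes "subalgebra M F" "e \<in> borel_measurable M"
    and eq: "\<And>w. w \<in> space M \<Longrightarrow> E w = ennreal (e w)"
    and "AE w in M. nn_cond_exp M F E w \<le> c"
  shows "(\<integral>\<^sup>+ w. ennreal (e w) \<partial>M) \<le> c"
proof -
  have "E \<in> borel_measurable M" using assms(2) eq by (simp cong: measurable_cong)
  then have "(\<integral>\<^sup>+ w. E w \<partial>M) \<le> c" using assms(1,4) by (intro nn_integral_le_if_nn_cond_exp_le)
  then show ?thesis using eq by (simp cong: nn_integral_cong)
qed

text \<open>The contribution of iteration \<open>k\<close> to the accumulated gap.\<close>

definition weighted_error :: "nat \<Rightarrow> 'w \<Rightarrow> real" where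
  "weighted_error k w = (real k + 2) * (real k + 3) *
     (\<tau> k * primal_error k lt k w + 2 * dual_error k w + primal_error (Suc k) lu k w)"

lemma weighted_error:
  assumes k: "k < K"
  shows "weighted_error k \<in> borel_measurable M" "w \<in> space M \<Longrightarrow> 0 \<le> weighted_error k w"
    and "(\<integral>\<^sup>+ w. ennreal (weighted_error k w) \<partial>M) \<le> ennreal ((real k + 2) * (\<epsilon> * \<delta> / (3 * real K)))"
proof -
  define a b where "a = (real k + 2) * (real k + 3)" and "b = \<epsilon> / (4 * (real k + 3)) * \<delta> / (3 * real K)"
  have a: "a \<ge> 0" and b: "b \<ge> 0" using \<epsilon> \<delta> by (auto simp: a_def b_def)
  have Suc: "Suc k \<le> K" "k \<le> K" using k by auto
  note e1 = primal_error[where u = lt, OF Suc(2) step1_rv[OF k] step1_mem[OF k]]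
  note e2 = dual_error[OF k]
  note e3 = primal_error[where u = lu, OF Suc(1) step6_rv[OF k] step6_mem[OF k]]
  have i1: "(\<integral>\<^sup>+ w. ennreal (primal_error k lt k w) \<partial>M) \<le> ennreal b"
    using nn_integral_error_le[OF F0_subalgebra[OF Suc(2)] e1(1,3) step1[OF k]] by (simp add: b_def \<eta>)
  have i2: "(\<integral>\<^sup>+ w. ennreal (dual_error k w) \<partial>M) \<le> ennreal b"
    using nn_integral_error_le[OF F1_subalgebra[OF k] e2(1,3) step3[OF k]] by (simp add: b_def \<gamma>)
  have i3: "(\<integral>\<^sup>+ w. ennreal (primal_error (Suc k) lu k w) \<partial>M) \<le> ennreal b"
    using nn_integral_error_le[OF F2_subalgebra[OF k] e3(1,3) step6[OF k]] by (simp add: b_def \<eta>)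
  have eq: "weighted_error k w = a * \<tau> k * primal_error k lt k w + 2 * a * dual_error k w
      + a * primal_error (Suc k) lu k w" for w
    by (simp add: weighted_error_def a_def algebra_simps)
  show "weighted_error k \<in> borel_measurable M"
    unfolding eq using e1(1) e2(1) e3(1) by measurable
  show "0 \<le> weighted_error k w" if "w \<in> space M"
    unfolding eq using e1(2) e2(2) e3(2) that a \<tau>_bounds[of k] by simp
  have "(\<integral>\<^sup>+ w. ennreal (weighted_error k w) \<partial>M) \<le> ennreal ((a * \<tau> k + 2 * a + a) * b)"
    unfolding eq using a b \<tau>_bounds[of k] e1 e2 e3 i1 i2 i3
    by (intro nn_integral_weighted_errors_le) auto
  also have "\<dots> \<le> ennreal (4 * a * b)"
    using a b \<tau>_bounds[of k] mult_left_le[of "\<tau> k" a] by (intro ennreal_leI mult_right_mono) auto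
  also have "4 * a * b = (real k + 2) * (\<epsilon> * \<delta> / (3 * real K))"
    by (simp add: a_def b_def divide_simps)
  finally show "(\<integral>\<^sup>+ w. ennreal (weighted_error k w) \<partial>M)
      \<le> ennreal ((real k + 2) * (\<epsilon> * \<delta> / (3 * real K)))" .
qed

definition total_error :: "'w \<Rightarrow> real" where
  "total_error w = (\<Sum>k<K. weighted_error k w)"

text \<open>The solver tolerances sum to \<open>\<delta> \<epsilon> (K + 3) / 6\<close>, which is below the bound because \<open>K \<ge> 1\<close>.\<close>

lemma total_error:
  shows "total_error \<in> borel_measurable M"
    and "K > 0 \<Longrightarrow> (\<integral>\<^sup>+ w. ennreal (total_error w) \<partial>M) \<le> ennreal (\<delta> * (\<epsilon> * (real K * (real K + 3) / 2)))"
proof -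
  show "total_error \<in> borel_measurable M"
    unfolding total_error_def using weighted_error(1) by (intro borel_measurable_sum) auto
  assume K: "K > 0"
  have "(\<integral>\<^sup>+ w. ennreal (total_error w) \<partial>M) \<le> ennreal (\<Sum>k<K. (real k + 2) * (\<epsilon> * \<delta> / (3 * real K)))"
    unfolding total_error_def using weighted_error \<epsilon> \<delta> by (intro nn_integral_sum_le) auto
  also have "(\<Sum>k<K. (real k + 2) * (\<epsilon> * \<delta> / (3 * real K))) = \<epsilon> * \<delta> * (real K + 3) / 6"
  proof -
    have sum_eq: "(\<Sum>k<n. real k + 2) = real n * (real n + 3) / 2" for n
      by (induction n) (auto simp: field_simps)
    show ?thesis unfolding sum_distrib_right[symmetric] sum_eq using K by simp
  qed
  also have "ennreal (\<epsilon> * \<delta> * (real K + 3) / 6) \<le> ennreal (\<delta> * (\<epsilon> * (real K * (real K + 3) / 2)))"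
  proof (rule ennreal_leI)
    have "\<epsilon> * \<delta> * (real K + 3) * (1 / 6) \<le> \<epsilon> * \<delta> * (real K + 3) * (real K / 2)"
      using \<epsilon> \<delta> K by (intro mult_left_mono) auto
    then show "\<epsilon> * \<delta> * (real K + 3) / 6 \<le> \<delta> * (\<epsilon> * (real K * (real K + 3) / 2))"
      by (simp add: mult_ac)
  qed
  finally show "(\<integral>\<^sup>+ w. ennreal (total_error w) \<partial>M) \<le> ennreal (\<delta> * (\<epsilon> * (real K * (real K + 3) / 2)))" .
qed

lemma final_gap:
  assumes w: "w \<in> space M"
  shows "(real K + 1) * (real K + 2) * (primal (\<rho> K) (x K w) - dual (l K w))
           \<le> 2 * (primal (\<rho> 0) x0 - dual l0) + total_error w"
    and "\<rho> K = 16 * LD / ((real K + 1) * (real K + 2))"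
proof -
  have "x 0 w \<in> X" "l 0 w \<in> \<Lambda>" using start[OF w] start_mem by auto
  then have "(real K + 1) * (real K + 2) * (primal (\<rho> K) (x K w) - dual (l K w))
      \<le> 2 * (primal (\<rho> 0) (x 0 w) - dual (l 0 w)) + total_error w
      \<and> \<rho> K = 16 * LD / ((real K + 1) * (real K + 2)) \<and> x K w \<in> X \<and> l K w \<in> \<Lambda>"
    unfolding total_error_def weighted_error_def LD(1)
    by (rule accumulated_gap[where K = K and n = K and x = "\<lambda>k. x k w" and l = "\<lambda>k. l k w"
          and lh = "\<lambda>k. lh k w" and lt = "\<lambda>k. lt k w" and xt = "\<lambda>k. xt k w" and lu = "\<lambda>k. lu k w"])
      (use LD \<rho>0 \<tau> step3_mem step1_mem step6_mem step5 step2 step4 step7 w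
        in \<open>auto simp: primal_error_def dual_error_def\<close>)
  then show "(real K + 1) * (real K + 2) * (primal (\<rho> K) (x K w) - dual (l K w))
           \<le> 2 * (primal (\<rho> 0) x0 - dual l0) + total_error w"
    and "\<rho> K = 16 * LD / ((real K + 1) * (real K + 2))"
    using start[OF w] by auto
qed

lemma prob_ge_if_small_total_error:
  assumes K: "K > 0"
    and le: "\<And>w. w \<in> space M \<Longrightarrow> total_error w \<le> \<epsilon> * (real K * (real K + 3) / 2)
               \<Longrightarrow> primal r (x K w) - dual (l K w) \<le> \<epsilon>"
  shows "1 - \<delta> \<le> prob {w \<in> space M. primal r (x K w) - dual (l K w) \<le> \<epsilon>}"
proof (rule prob_ge_by_Markov[OF total_error(1) total_error(2)[OF K]])
  note [measurable] = iterates(1,2)[OF order.refl]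
  have [measurable]: "(\<lambda>w. primal r (x K w)) \<in> borel_measurable M"
    by (rule borel_measurable_primal) (use iterates(3)[OF order.refl] in auto)
  have [measurable]: "(\<lambda>w. dual (l K w)) \<in> borel_measurable M"
    by (rule borel_measurable_dual) (use iterates(4)[OF order.refl] in auto)
  show "{w \<in> space M. primal r (x K w) - dual (l K w) \<le> \<epsilon>} \<in> events" by measurable
qed (use le K \<epsilon> \<delta> in auto)

lemma prob_smoothed_gap_le:
  assumes K: "K > 0" and K_ge: "4 * (primal (\<rho> 0) x0 - dual l0) \<le> \<epsilon> * (real K)\<^sup>2"
  shows "1 - \<delta> \<le> prob {w \<in> space M. smoothed_gap X \<Lambda> S \<omega>' (\<rho> K) (x K w) (l K w) \<le> ereal \<epsilon>}"
proof -
  have "1 - \<delta> \<le> prob {w \<in> space M. primal (\<rho> K) (x K w) - dual (l K w) \<le> \<epsilon>}"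
  proof (rule prob_ge_if_small_total_error[OF K])
    fix w assume w: "w \<in> space M" and T: "total_error w \<le> \<epsilon> * (real K * (real K + 3) / 2)"
    show "primal (\<rho> K) (x K w) - dual (l K w) \<le> \<epsilon>"
      by (rule le_of_mult_le_by_iteration_count[OF _ K_ge \<epsilon>]) (use final_gap(1)[OF w] T in linarith)
  qed
  also have "{w \<in> space M. primal (\<rho> K) (x K w) - dual (l K w) \<le> \<epsilon>}
      = {w \<in> space M. smoothed_gap X \<Lambda> S \<omega>' (\<rho> K) (x K w) (l K w) \<le> ereal \<epsilon>}"
    using iterates(3,4)[OF order.refl]
    by (intro Collect_cong conj_cong) (auto simp: smoothed_gap_def primal_fun_smoothed dual_fun_S)
  finally show ?thesis .
qed

text \<open>Passing between the smoothed and the plain primal function changes its value by at most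
  \<open>\<rho> B\<omega>\<close>. At the start, \<open>\<rho> 0 = 8 LD\<close> counts twice, and at the end
  \<open>(K + 1) (K + 2) \<rho> K = 16 LD\<close>; together this is \<open>2 \<cdot> 16 LD B\<omega>\<close>.\<close>

lemma prob_gap_le:
  assumes K: "K > 0" and K_ge: "4 * (16 * LD * B\<omega> + (primal 0 x0 - dual l0)) \<le> \<epsilon> * (real K)\<^sup>2"
  shows "1 - \<delta> \<le> prob {w \<in> space M. gap X \<Lambda> S (x K w) (l K w) \<le> ereal \<epsilon>}"
proof -
  have "1 - \<delta> \<le> prob {w \<in> space M. primal 0 (x K w) - dual (l K w) \<le> \<epsilon>}"
  proof (rule prob_ge_if_small_total_error[OF K])
    fix w assume w: "w \<in> space M" and T: "total_error w \<le> \<epsilon> * (real K * (real K + 3) / 2)"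
    define A where "A = (real K + 1) * (real K + 2)"
    have A: "A > 0" by (simp add: A_def add_pos_nonneg)
    have "primal 0 (x K w) \<le> primal (\<rho> K) (x K w) + \<rho> K * B\<omega>"
      using primal_diff_le[OF iterates(3)[OF order.refl w], of 0 "\<rho> K"] final_gap(2)[OF w] LD(2) by simp
    then have "A * (primal 0 (x K w) - dual (l K w))
        \<le> A * (primal (\<rho> K) (x K w) - dual (l K w)) + A * (\<rho> K * B\<omega>)"
      using mult_left_mono[OF _ less_imp_le[OF A]] by (simp add: distrib_left[symmetric])
    moreover have "A * (\<rho> K * B\<omega>) = 16 * LD * B\<omega>"
      using A final_gap(2)[OF w] by (simp add: A_def[symmetric])
    moreover have "primal (\<rho> 0) x0 \<le> primal 0 x0 + 8 * LD * B\<omega>"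
      using primal_diff_le[OF start_mem(1), of "\<rho> 0" 0] LD(2) by (simp add: \<rho>0)
    moreover have "2 * (16 * LD * B\<omega> + (primal 0 x0 - dual l0))
        = 16 * LD * B\<omega> + 2 * (primal 0 x0 + 8 * LD * B\<omega> - dual l0)" by simp
    ultimately have "A * (primal 0 (x K w) - dual (l K w))
        \<le> 2 * (16 * LD * B\<omega> + (primal 0 x0 - dual l0)) + \<epsilon> * (real K * (real K + 3) / 2)"
      using final_gap(1)[OF w, folded A_def] T by argo
    then show "primal 0 (x K w) - dual (l K w) \<le> \<epsilon>"
      unfolding A_def using K_ge \<epsilon> by (rule le_of_mult_le_by_iteration_count)
  qed
  also have "{w \<in> space M. primal 0 (x K w) - dual (l K w) \<le> \<epsilon>}
      = {w \<in> space M. gap X \<Lambda> S (x K w) (l K w) \<le> ereal \<epsilon>}"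
    using iterates(3,4)[OF order.refl]
    by (intro Collect_cong conj_cong) (auto simp: gap_def primal_fun_S dual_fun_S)
  finally show ?thesis .
qed

end

section \<open>The complexity theorem\<close>

theorem theorem4p4:
  fixes X :: "'a::fin_dim_normed set" and \<Lambda> :: "'b::fin_dim_normed set"
    and f g :: "'a \<Rightarrow> ereal" and h \<omega> :: "'b \<Rightarrow> ereal"
    and \<Phi> :: "'a \<Rightarrow> 'b \<Rightarrow> real"
    and S :: "'a \<Rightarrow> 'b \<Rightarrow> ereal"
    and \<mu> L Lxx Llx Lll LD \<epsilon> \<delta> :: real
    and \<rho> \<tau> \<gamma> \<eta> :: "nat \<Rightarrow> real"
    and K :: nat
    and M :: "'w measure"
    and x0 :: 'a and l0 :: 'b
    and x xt :: "nat \<Rightarrow> 'w \<Rightarrow> 'a" and l lh lt lu :: "nat \<Rightarrow> 'w \<Rightarrow> 'b"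
  assumes X: "X \<noteq> {}" "closed X" "convex X" "bounded X"
    and \<Lambda>: "\<Lambda> \<noteq> {}" "closed \<Lambda>" "convex \<Lambda>"
    and fgh: "closed_convex_proper f" "closed_convex_proper g" "closed_convex_proper h"
    and dom: "X \<subseteq> edom g" "\<Lambda> \<subseteq> edom h"
    and f_diff: "\<exists>U. open U \<and> X \<subseteq> U \<and> U \<subseteq> edom f \<and>
                   (\<forall>z\<in>U. (\<lambda>y. real_of_ereal (f y)) differentiable (at z))"
    and \<mu>_L: "0 < \<mu>" "\<mu> \<le> L"
    and f_lower: "\<forall>z\<in>X. \<forall>z'\<in>X. \<mu> / 2 * (norm (z - z'))\<^sup>2 \<le>
        real_of_ereal (f z) - real_of_ereal (f z') - grad (\<lambda>y. real_of_ereal (f y)) z' (z - z')"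
    and f_upper: "\<forall>z\<in>X. \<forall>z'\<in>X.
        real_of_ereal (f z) - real_of_ereal (f z') - grad (\<lambda>y. real_of_ereal (f y)) z' (z - z')
          \<le> L / 2 * (norm (z - z'))\<^sup>2"
    and \<Phi>_convex: "\<And>v. convex_on UNIV (\<lambda>z. \<Phi> z v)"
    and \<Phi>_concave: "\<And>z. concave_on UNIV (\<lambda>v. \<Phi> z v)"
    and \<Phi>_diff1: "\<And>z v. (\<lambda>y. \<Phi> y v) differentiable (at z)"
    and \<Phi>_diff2: "\<And>z v. (\<lambda>y. \<Phi> z y) differentiable (at v)"
    and \<Phi>_xx: "\<And>v. v \<in> \<Lambda> \<Longrightarrow> Lxx-lipschitz_on X (\<lambda>z. grad (\<lambda>y. \<Phi> y v) z)"
    and \<Phi>_xl: "\<And>z. z \<in> X \<Longrightarrow> Llx-lipschitz_on \<Lambda> (\<lambda>v. grad (\<lambda>y. \<Phi> y v) z)"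
    and \<Phi>_lx: "\<And>v. v \<in> \<Lambda> \<Longrightarrow> Llx-lipschitz_on X (\<lambda>z. grad (\<lambda>y. \<Phi> z y) v)"
    and \<Phi>_ll: "\<And>z. z \<in> X \<Longrightarrow> Lll-lipschitz_on \<Lambda> (\<lambda>v. grad (\<lambda>y. \<Phi> z y) v)"
    and S: "S = (\<lambda>z v. f z + g z + ereal (\<Phi> z v) - h v)"
    and saddle: "\<exists>z\<in>X. \<exists>v\<in>\<Lambda>. \<forall>z'\<in>X. \<forall>v'\<in>\<Lambda>. S z v' \<le> S z v \<and> S z v \<le> S z' v"
    and \<omega>: "closed_convex_proper \<omega>" "\<Lambda> \<subseteq> edom \<omega>" "strongly_convex_on 1 \<Lambda> \<omega>"
      "continuous_on \<Lambda> \<omega>" "essentially_smooth \<omega>"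
    and LD: "LD = Lll + Llx\<^sup>2 / \<mu>" "LD > 0"
    and \<Lambda>_bounded: "bounded \<Lambda>"
    and \<epsilon>: "\<epsilon> > 0" and \<delta>: "0 < \<delta>" "\<delta> < 1"
    and run: "ipds_run M X \<Lambda> S \<omega> \<delta> K \<rho> \<tau> \<gamma> \<eta> x0 l0 x l lh lt xt lu"
    and \<rho>0: "\<rho> 0 = 8 * LD"
    and \<tau>: "\<And>k. \<tau> k = (real k + 1) / (real k + 3)"
    and \<gamma>: "\<And>k. \<gamma> k = \<epsilon> / (4 * (real k + 3))"
    and \<eta>: "\<And>k. \<eta> k = \<epsilon> / (4 * (real k + 3))"
  shows "(K = 2 * nat \<lceil>sqrt (real_of_ereal (max (smoothed_gap X \<Lambda> S \<omega> (\<rho> 0) x0 l0) 0) / \<epsilon>)\<rceil> + 1 \<longrightarrow>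
            measure M {w \<in> space M. smoothed_gap X \<Lambda> S \<omega> (\<rho> K) (x K w) (l K w) \<le> ereal \<epsilon>}
              \<ge> 1 - \<delta>)
       \<and> (K = nat \<lceil>2 * sqrt (real_of_ereal
                     (ereal (16 * LD) * (SUP v\<in>\<Lambda>. \<bar>\<omega> v\<bar>) + gap X \<Lambda> S x0 l0)) / sqrt \<epsilon>\<rceil> + 1 \<longrightarrow>
            measure M {w \<in> space M. gap X \<Lambda> S (x K w) (l K w) \<le> ereal \<epsilon>} \<ge> 1 - \<delta>)"
proof -
  define p where "p z = real_of_ereal (f z) + real_of_ereal (g z)" for z
  define q where "q v = real_of_ereal (h v)" for v
  define \<omega>r where "\<omega>r v = real_of_ereal (\<omega> v)" for v
  define B\<omega> where "B\<omega> = (SUP v\<in>\<Lambda>. \<bar>\<omega>r v\<bar>)"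
  have X_edom_f: "X \<subseteq> edom f" using f_diff by blast
  have fin: "z \<in> X \<Longrightarrow> f z = ereal (real_of_ereal (f z))" "z \<in> X \<Longrightarrow> g z = ereal (real_of_ereal (g z))"
    "v \<in> \<Lambda> \<Longrightarrow> h v = ereal (q v)" "v \<in> \<Lambda> \<Longrightarrow> \<omega> v = ereal (\<omega>r v)" for z v
    using fgh \<omega>(1,2) dom X_edom_f unfolding closed_convex_proper_def q_def \<omega>r_def
    by (blast intro: real_of_ereal_works_on_edom[symmetric])+
  have S_eq: "S z v = ereal (p z + \<Phi> z v - q v)" if "z \<in> X" "v \<in> \<Lambda>" for z v
    unfolding S by (subst fin(1)[OF that(1)], subst fin(2)[OF that(1)], subst fin(3)[OF that(2)]) (simp add: p_def)
  have bdd_\<omega>: "bdd_above ((\<lambda>v. \<bar>\<omega>r v\<bar>) ` \<Lambda>)"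
  proof -
    have "continuous_on \<Lambda> \<omega>r"
    proof -
      have "\<bar>\<omega> v\<bar> \<noteq> \<infinity>" if "v \<in> \<Lambda>" for v using fin(4)[OF that] by simp
      then show ?thesis
        using \<omega>(4) continuous_on_iff_real[of \<Lambda> \<omega>] unfolding \<omega>r_def[abs_def] comp_def by blast
    qed
    moreover have "compact \<Lambda>" using \<Lambda>(2) \<Lambda>_bounded by (simp add: compact_eq_bounded_closed)
    ultimately have "compact ((\<lambda>v. \<bar>\<omega>r v\<bar>) ` \<Lambda>)"
      by (intro compact_continuous_image continuous_intros)
    then show ?thesis by (intro bounded_imp_bdd_above compact_imp_bounded)
  qed
  have \<omega>r_le: "\<bar>\<omega>r v\<bar> \<le> B\<omega>" if "v \<in> \<Lambda>" for v
    unfolding B\<omega>_def using bdd_\<omega> that by (intro cSUP_upper)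
  have SUP_\<omega>: "(SUP v\<in>\<Lambda>. \<bar>\<omega> v\<bar>) = ereal B\<omega>"
  proof -
    have "(SUP v\<in>\<Lambda>. \<bar>\<omega> v\<bar>) = (SUP v\<in>\<Lambda>. ereal \<bar>\<omega>r v\<bar>)" by (intro SUP_cong) (simp_all add: fin(4))
    also have "\<dots> = ereal B\<omega>"
      unfolding B\<omega>_def using \<Lambda>(1) \<omega>r_le
      by (intro ereal_SUP[symmetric] ereal_SUP_not_infty[of _ 0 "ereal B\<omega>"]) auto
    finally show ?thesis .
  qed
  have meas: "p \<in> borel_measurable borel" "q \<in> borel_measurable borel" "\<omega>r \<in> borel_measurable borel"
    using fgh \<omega>(1) unfolding p_def[abs_def] q_def[abs_def] \<omega>r_def[abs_def]
    by (auto intro!: borel_measurable_add borel_measurable_real_of_ereal borel_measurable_if_closed_convex_proper)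
  have p_strong: "midpoint_strongly_convex_on \<mu> X p"
  proof -
    have "midpoint_strongly_convex_on \<mu> X (\<lambda>z. real_of_ereal (f z))"
      using f_lower X(3) by (intro midpoint_strongly_convex_on_if_grad_growth) auto
    moreover have "convex_on X (\<lambda>z. real_of_ereal (g z))"
      using fgh(2) dom(1) X(3) by (rule convex_on_real_of_ereal)
    ultimately show ?thesis unfolding p_def[abs_def] by (rule midpoint_strongly_convex_on_add_convex)
  qed
  interpret composite_ipds_run X \<Lambda> p q \<omega>r \<Phi> \<mu> Llx Lll B\<omega> M S \<omega> \<delta> K \<rho> \<tau> \<gamma> \<eta> x0 l0 x l lh lt xt lu \<epsilon> LD
  proof (intro composite_ipds_run.intro smooth_saddle_problem.intro composite_ipds_run_axioms.intro run)
    show "convex_on X p"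
      unfolding p_def[abs_def]
      using convex_on_real_of_ereal[OF fgh(1) X_edom_f X(3)] convex_on_real_of_ereal[OF fgh(2) dom(1) X(3)]
      by (rule convex_on_add)
    show "convex_on \<Lambda> q"
      unfolding q_def[abs_def] using fgh(3) dom(2) \<Lambda>(3) by (rule convex_on_real_of_ereal)
    show "midpoint_strongly_convex_on 1 \<Lambda> \<omega>r"
      unfolding \<omega>r_def[abs_def] using \<omega>(1,2,3) \<Lambda>(3)
      by (intro midpoint_strongly_convex_on_real_of_ereal) (auto simp: closed_convex_proper_def)
    obtain z v where zv: "z \<in> X" "v \<in> \<Lambda>" "\<And>z' v'. z' \<in> X \<Longrightarrow> v' \<in> \<Lambda> \<Longrightarrow> S z v' \<le> S z v \<and> S z v \<le> S z' v"
      using saddle by blast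
    show "\<exists>z\<in>X. \<exists>v\<in>\<Lambda>. \<forall>z'\<in>X. \<forall>v'\<in>\<Lambda>. p z + \<Phi> z v' - q v' \<le> p z + \<Phi> z v - q v
        \<and> p z + \<Phi> z v - q v \<le> p z' + \<Phi> z' v - q v"
    proof (intro bexI[of _ z] bexI[of _ v] ballI)
      fix z' v' assume "z' \<in> X" "v' \<in> \<Lambda>"
      then show "p z + \<Phi> z v' - q v' \<le> p z + \<Phi> z v - q v \<and> p z + \<Phi> z v - q v \<le> p z' + \<Phi> z' v - q v"
        using zv by (simp add: S_eq del: diff_le_eq)
    qed (use zv in auto)
  qed (use X \<Lambda> \<Lambda>_bounded p_strong \<mu>_L \<omega>r_le \<Phi>_convex \<Phi>_concave \<Phi>_diff1 \<Phi>_diff2 \<Phi>_xl \<Phi>_lx \<Phi>_ll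
      S_eq fin(4) meas LD \<epsilon> \<delta> \<rho>0 \<tau> \<gamma> \<eta> in auto)
  have start_gap: "smoothed_gap X \<Lambda> S \<omega> (\<rho> 0) x0 l0 = ereal (primal (\<rho> 0) x0 - dual l0)"
    "gap X \<Lambda> S x0 l0 = ereal (primal 0 x0 - dual l0)"
    using start_mem by (simp_all add: smoothed_gap_def gap_def primal_fun_smoothed primal_fun_S dual_fun_S)
  show ?thesis
  proof (intro conjI impI)
    assume K: "K = 2 * nat \<lceil>sqrt (real_of_ereal (max (smoothed_gap X \<Lambda> S \<omega> (\<rho> 0) x0 l0) 0) / \<epsilon>)\<rceil> + 1"
    define V where "V = max (primal (\<rho> 0) x0 - dual l0) 0"
    have "real_of_ereal (max (smoothed_gap X \<Lambda> S \<omega> (\<rho> 0) x0 l0) 0) = V"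
      unfolding start_gap V_def by (simp add: max_def zero_ereal_def)
    then have "K = 2 * nat \<lceil>sqrt (V / \<epsilon>)\<rceil> + 1" using K by simp
    then have "2 * sqrt (V / \<epsilon>) \<le> real K"
      using real_nat_ceiling_ge[of "sqrt (V / \<epsilon>)"] by simp
    moreover have "0 \<le> 2 * sqrt (V / \<epsilon>)" using \<epsilon> by (simp add: V_def)
    ultimately have "(2 * sqrt (V / \<epsilon>))\<^sup>2 \<le> (real K)\<^sup>2" by (rule power_mono)
    then have "4 * V \<le> \<epsilon> * (real K)\<^sup>2"
      using \<epsilon> by (simp add: V_def power_mult_distrib field_simps)
    moreover have "primal (\<rho> 0) x0 - dual l0 \<le> V" by (simp add: V_def)
    ultimately have "4 * (primal (\<rho> 0) x0 - dual l0) \<le> \<epsilon> * (real K)\<^sup>2" by argo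
    then show "1 - \<delta> \<le> prob {w \<in> space M. smoothed_gap X \<Lambda> S \<omega> (\<rho> K) (x K w) (l K w) \<le> ereal \<epsilon>}"
      using K by (intro prob_smoothed_gap_le) auto
  next
    assume K: "K = nat \<lceil>2 * sqrt (real_of_ereal
                     (ereal (16 * LD) * (SUP v\<in>\<Lambda>. \<bar>\<omega> v\<bar>) + gap X \<Lambda> S x0 l0)) / sqrt \<epsilon>\<rceil> + 1"
    define V where "V = 16 * LD * B\<omega> + (primal 0 x0 - dual l0)"
    have "dual l0 \<le> primal 0 x0"
      using dual_le_payoff[OF start_mem] payoff_le_primal[OF start_mem, of 0] by simp
    moreover have "0 \<le> B\<omega>" using \<omega>r_le[OF start_mem(2)] by simp
    ultimately have V: "0 \<le> V" using LD(2) by (simp add: V_def)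
    have "real_of_ereal (ereal (16 * LD) * (SUP v\<in>\<Lambda>. \<bar>\<omega> v\<bar>) + gap X \<Lambda> S x0 l0) = V"
      unfolding start_gap SUP_\<omega> V_def by simp
    then have "K = nat \<lceil>2 * sqrt V / sqrt \<epsilon>\<rceil> + 1" using K by simp
    then have "2 * sqrt V / sqrt \<epsilon> \<le> real K"
      using real_nat_ceiling_ge[of "2 * sqrt V / sqrt \<epsilon>"] by simp
    moreover have "0 \<le> 2 * sqrt V / sqrt \<epsilon>" using \<epsilon> V by simp
    ultimately have "(2 * sqrt V / sqrt \<epsilon>)\<^sup>2 \<le> (real K)\<^sup>2" by (rule power_mono)
    then have "4 * V \<le> \<epsilon> * (real K)\<^sup>2"
      using \<epsilon> V by (simp add: power_mult_distrib power_divide field_simps)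
    then show "1 - \<delta> \<le> prob {w \<in> space M. gap X \<Lambda> S (x K w) (l K w) \<le> ereal \<epsilon>}"
      unfolding V_def using K by (intro prob_gap_le) auto
  qed
qed

end
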